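(* Fix $0<\alpha<\infty$ and $0<p<\infty$. For every $f\in A^p_\alpha$ and every $w\in\mathbb{D}$, $$|f(w)|^p(1-|w|^2)^\alpha\le\|f\|_{\alpha,p}^p.$$ Moreover, for $f\in A^p_\alpha$ and $w\in\mathbb{D}$, equality holds in this estimate if and only if $f(z)=C(1-\overline{w}z)^{-2\alpha/p}$ for all $z\in\mathbb{D}$, for some constant $C\in\mathbb{C}$.
   Context: $\mathbb{D}$ is the open unit disc in $\mathbb{C}$. For $f$ analytic in $\mathbb{D}$, $0<p<\infty$ and $0<r<1$, set $M_p^p(r,f)=\int_0^{2\pi}|f(re^{i\theta})|^p\,\frac{d\theta}{2\pi}$; the function $r\mapsto M_p^p(r,f)$ is increasing and differentiable on $(0,1)$. For $0<\alpha,p<\infty$ define $$\|f\|_{\alpha,p}^p=|f(0)|^p+\int_0^1\left(\frac{d}{dr}M_p^p(r,f)\right)(1-r^2)^{\alpha-1}\,dr\in[0,\infty],$$ and let $A^p_\alpha$ be the class of all analytic functions $f$ in $\mathbb{D}$ with $\|f\|_{\alpha,p}<\infty$. Powers of $1-\overline{w}z$ (which has positive real part) are taken with the principal branch. *)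

theory Defs
  imports "HOL-Complex_Analysis.Complex_Analysis"
begin

definition integral_mean_pow :: "real \<Rightarrow> real \<Rightarrow> (complex \<Rightarrow> complex) \<Rightarrow> real"
  where "integral_mean_pow p r f =
    integral {0..2*pi} (\<lambda>\<theta>. norm (f (of_real r * exp (\<i> * of_real \<theta>))) powr p / (2*pi))"

(* This is the p-th power of the norm, with values in [0,\<infinity>]. For f holomorphic on the unit disc
   and p > 0, the mean is differentiable and increasing in r on (0,1), so the coercion
   ennreal, which sends negative numbers to 0, truncates nothing. *)
definition wnorm_pow :: "real \<Rightarrow> real \<Rightarrow> (complex \<Rightarrow> complex) \<Rightarrow> ennreal"
  where "wnorm_pow \<alpha> p f =
    ennreal (norm (f 0) powr p) +
    (\<integral>\<^sup>+ r \<in> {0<..<1}.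
       ennreal (deriv (\<lambda>s. integral_mean_pow p s f) r * (1 - r\<^sup>2) powr (\<alpha> - 1)) \<partial>lborel)"

(* Functions on the disc are represented by total functions on the complex plane; the values
   outside the unit disc are arbitrary and affect neither membership nor wnorm_pow. *)
definition A_space :: "real \<Rightarrow> real \<Rightarrow> (complex \<Rightarrow> complex) set"
  where "A_space \<alpha> p = {f. f holomorphic_on ball 0 1 \<and> wnorm_pow \<alpha> p f < \<infinity>}"

end

theory Submission imports Defs begin

text \<open>
  Write \<open>M(r)\<close> for the mean of \<open>|f|\<^sup>p\<close> over the circle of radius \<open>r\<close>, and \<open>\<phi>(r) = (1 - r\<^sup>2)\<^sup>\<alpha>\<^sup>-\<^sup>1\<close>, so
  that the \<open>p\<close>-th power of the norm is \<open>|f(0)|\<^sup>p + \<integral> M' \<phi>\<close> over \<open>(0,1)\<close>.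

  Functions without zeros. Here \<open>|f|\<^sup>p = |G|\<^sup>2\<close> with \<open>G = f\<^sup>p\<^sup>/\<^sup>2\<close> holomorphic. If \<open>G\<close> has the Taylor
  coefficients \<open>a\<^sub>n\<close>, then by Parseval the norm becomes \<open>\<Sum> c\<^sub>n |a\<^sub>n|\<^sup>2\<close> with
  \<open>c\<^sub>n = n! / (\<alpha>)\<^sub>n\<close>, where \<open>(\<alpha>)\<^sub>n\<close> is the rising factorial. Since \<open>\<Sum> x\<^sup>n / c\<^sub>n = (1 - x)\<^sup>-\<^sup>\<alpha>\<close> by
  the binomial series, the Cauchy-Schwarz inequality applied to \<open>G(w) = \<Sum> a\<^sub>n w\<^sup>n\<close> is exactly the claimed
  estimate, and equality forces \<open>a\<^sub>n\<close> to be proportional to \<open>cnj w\<^sup>n / c\<^sub>n\<close>, that is,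
  \<open>G\<close> to be a multiple of \<open>(1 - cnj w z)\<^sup>-\<^sup>\<alpha>\<close>
  (\<open>wnorm_pow_zero_free_ge\<close>, \<open>wnorm_pow_zero_free_equality\<close>, \<open>wnorm_pow_kernel\<close>).

  Functions with a zero \<open>a\<close>. It suffices to show that the inequality is strict whenever \<open>f(w)\<close> is
  nonzero: if equality holds at a point \<open>w\<close> with \<open>f(w) = 0\<close>, then the norm of \<open>f\<close> vanishes, and the strict
  inequality at another point shows that \<open>f\<close> vanishes identically.

  For \<open>\<alpha> \<le> 1\<close> (\<open>wnorm_pow_strict_of_zero_le_1\<close>) the weight \<open>\<phi>\<close> is nondecreasing. On the disc of radius
  \<open>R < 1\<close> divide \<open>f\<close> by the finite Blaschke product of its zeros there; the quotient \<open>g\<close> has no zeros,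
  \<open>|g| = |f|\<close> on the circle of radius \<open>R\<close> and \<open>|g| \<ge> |f|\<close> inside it. Integration by parts writes the norm
  truncated at \<open>R\<close> as \<open>M(R) \<phi>(R) - \<integral> M \<phi>'\<close>, which therefore does not increase when \<open>f\<close> is replaced by \<open>g\<close>.
  The case without zeros, applied to \<open>g\<close>, and \<open>R \<rightarrow> 1\<close> give the estimate with the additional factor
  \<open>|(w - a) / (1 - cnj a w)|\<^sup>-\<^sup>p > 1\<close>.

  For \<open>\<alpha> > 1\<close> (\<open>wnorm_pow_strict_of_zero_gt_1\<close>) integration by parts bounds the norm from below by the
  weighted area integral of \<open>|f|\<^sup>p (1 - |z|\<^sup>2)\<^sup>\<alpha>\<^sup>-\<^sup>2\<close>. This integral does not change when \<open>f\<close> is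
  replaced by \<open>F = (f \<circ> \<Phi>) \<Phi>'\<^sup>\<alpha>\<^sup>/\<^sup>p\<close> with a disc automorphism \<open>\<Phi>\<close> taking \<open>0\<close> to \<open>w\<close>
  (\<open>polar_integral_invariant\<close>), and \<open>|F(0)|\<^sup>p = |f(w)|\<^sup>p (1 - |w|\<^sup>2)\<^sup>\<alpha>\<close>. Now each circular mean of
  \<open>|F|\<^sup>p\<close> is at least \<open>|F(0)|\<^sup>p\<close>, strictly on the circles that surround a zero.
\<close>

section \<open>Parseval on circles\<close>

lemma powser_abs_summable:
  fixes a :: "nat \<Rightarrow> complex"
  assumes "\<And>z. norm z < \<rho> \<Longrightarrow> (\<lambda>n. a n * z ^ n) sums G z" "norm z < \<rho>"
  shows "summable (\<lambda>n. norm (a n * z ^ n))"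
proof -
  obtain r where r: "norm z < r" "r < \<rho>" using assms(2) dense by blast
  then have "0 < r" using norm_ge_zero le_less_trans by blast
  have "summable (\<lambda>n. a n * of_real r ^ n)"
    using assms(1)[of "of_real r"] r \<open>0 < r\<close> by (auto simp: sums_iff)
  then show ?thesis
    by (rule powser_insidea) (use r \<open>0 < r\<close> in auto)
qed

text \<open>Orthogonality of the characters of the circle.\<close>

lemma has_integral_circle_exponential:
  fixes k :: int
  shows "((\<lambda>t. exp (\<i> * of_real t) powi k) has_integral (if k = 0 then 2 * pi else 0)) {0..2*pi}"
proof (cases "k = 0")
  case True
  then show ?thesis
    using has_integral_const_real[of "1::complex" 0 "2*pi"] by (simp add: scaleR_conv_of_real)
next
  case False
  have "((\<lambda>t. exp (\<i> * of_int k * of_real t)) has_integral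
      exp (\<i> * of_int k * of_real (2*pi)) / (\<i> * of_int k) - exp (\<i> * of_int k * of_real 0) / (\<i> * of_int k)) {0..2*pi}"
  proof (rule fundamental_theorem_of_calculus)
    fix t :: real
    have "((\<lambda>z. exp (\<i> * of_int k * z) / (\<i> * of_int k)) has_field_derivative exp (\<i> * of_int k * of_real t)) (at (of_real t))"
      using False by (auto intro!: derivative_eq_intros)
    from field_vector_diff_chain_at[OF has_vector_derivative_of_real[OF DERIV_ident] this]
    show "((\<lambda>t. exp (\<i> * of_int k * of_real t) / (\<i> * of_int k)) has_vector_derivative exp (\<i> * of_int k * of_real t)) (at t within {0..2*pi})"
      by (simp add: o_def has_vector_derivative_at_within)
  qed simp
  also have "exp (\<i> * of_int k * of_real (2*pi)) = 1"
    using exp_integer_2pi[of "of_int k"] by (simp add: mult_ac)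
  finally show ?thesis
    using False by (simp add: exp_power_int mult_ac)
qed

lemma parseval_finite:
  fixes c :: "nat \<Rightarrow> complex"
  shows "((\<lambda>t. (norm (\<Sum>n<N. c n * exp (\<i> * of_real t) ^ n))\<^sup>2) has_integral (2 * pi * (\<Sum>n<N. (norm (c n))\<^sup>2))) {0..2*pi}"
proof -
  have eq: "of_real ((norm (\<Sum>n<N. c n * exp (\<i> * of_real t) ^ n))\<^sup>2) =
      (\<Sum>m<N. \<Sum>n<N. c m * cnj (c n) * exp (\<i> * of_real t) powi (int m - int n))" for t :: real
  proof -
    have "cnj (exp (\<i> * of_real t)) = inverse (exp (\<i> * of_real t))"
      by (simp add: exp_cnj exp_minus)
    then show ?thesis
      by (simp add: complex_norm_square[unfolded of_real_power[symmetric]] sum_product power_int_diff divide_inverse power_inverse mult_ac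
          del: of_real_power)
  qed
  have "((\<lambda>t. \<Sum>m<N. \<Sum>n<N. c m * cnj (c n) * exp (\<i> * of_real t) powi (int m - int n)) has_integral
      (\<Sum>m<N. \<Sum>n<N. c m * cnj (c n) * (if int m - int n = 0 then 2 * pi else 0))) {0..2*pi}"
    by (intro has_integral_sum has_integral_mult_right has_integral_circle_exponential) auto
  also have "(\<Sum>m<N. \<Sum>n<N. c m * cnj (c n) * (if int m - int n = 0 then 2 * pi else 0)) =
      (\<Sum>m<N. \<Sum>n<N. if n = m then of_real (2 * pi * (norm (c n))\<^sup>2) else 0)"
    by (intro sum.cong refl) (auto simp: complex_norm_square[symmetric] mult_ac)
  also have "\<dots> = of_real (2 * pi * (\<Sum>n<N. (norm (c n))\<^sup>2))"
    by (simp add: sum_distrib_left)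
  finally have "((\<lambda>t. complex_of_real ((norm (\<Sum>n<N. c n * exp (\<i> * of_real t) ^ n))\<^sup>2)) has_integral
      of_real (2 * pi * (\<Sum>n<N. (norm (c n))\<^sup>2))) {0..2*pi}"
    by (simp only: eq)
  from has_integral_linear[OF this bounded_linear_Re] show ?thesis
    by (simp add: o_def)
qed

text \<open>The coefficients are arbitrary subject to summing to \<open>G\<close>, so that the statement applies both to
  the Taylor series of a given function and to an explicitly given series.\<close>

lemma parseval_circle:
  fixes a :: "nat \<Rightarrow> complex"
  assumes G: "\<And>z. norm z < \<rho> \<Longrightarrow> (\<lambda>n. a n * z ^ n) sums G z" and r: "0 \<le> r" "r < \<rho>"
  shows "(\<lambda>n. (norm (a n))\<^sup>2 * r ^ (2 * n)) sums integral_mean_pow 2 r G"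
proof -
  define c where "c n = a n * of_real r ^ n" for n
  define s where "s N t = (\<Sum>n<N. c n * exp (\<i> * of_real t) ^ n)" for N and t :: real
  have s_lim: "suminf (\<lambda>n. c n * exp (\<i> * of_real t) ^ n) = G (of_real r * exp (\<i> * of_real t))" for t
    using G[of "of_real r * exp (\<i> * of_real t)"] r
    by (simp add: sums_iff c_def norm_mult power_mult_distrib mult_ac)
  have "summable (\<lambda>n. norm (c n))"
    unfolding c_def by (rule powser_abs_summable[OF G]) (use r in auto)
  then have "uniform_limit {0..2*pi} s (\<lambda>t. suminf (\<lambda>n. c n * exp (\<i> * of_real t) ^ n)) sequentially"
    unfolding s_def by (intro Weierstrass_m_test) (auto simp: norm_mult norm_power)
  then have u: "uniform_limit {0..2*pi} s (\<lambda>t. G (of_real r * exp (\<i> * of_real t))) sequentially"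
    by (simp add: s_lim)
  have contG: "continuous_on {0..2*pi} (\<lambda>t. G (of_real r * exp (\<i> * of_real t)))"
    by (rule uniform_limit_theorem[OF _ u]) (auto simp: s_def intro!: always_eventually continuous_intros)
  have bdd: "bounded ((\<lambda>t. G (of_real r * exp (\<i> * of_real t))) ` {0..2*pi})"
    by (intro compact_imp_bounded compact_continuous_image contG) simp
  have un: "uniform_limit {0..2*pi} (\<lambda>N t. norm (s N t)) (\<lambda>t. norm (G (of_real r * exp (\<i> * of_real t)))) sequentially"
    by (rule uniform_limit_norm[OF u])
  have "uniform_limit {0..2*pi} (\<lambda>N t. norm (s N t) * norm (s N t))
      (\<lambda>t. norm (G (of_real r * exp (\<i> * of_real t))) * norm (G (of_real r * exp (\<i> * of_real t)))) sequentially"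
    by (rule uniform_lim_mult[OF un un])
       (use bounded_norm_comp[of "\<lambda>t. G (of_real r * exp (\<i> * of_real t))"] bdd in \<open>auto simp: image_image\<close>)
  then have u2: "uniform_limit (cbox 0 (2*pi)) (\<lambda>N t. (norm (s N t))\<^sup>2)
      (\<lambda>t. (norm (G (of_real r * exp (\<i> * of_real t))))\<^sup>2) sequentially"
    by (simp add: power2_eq_square)
  have "continuous_on (cbox 0 (2*pi)) (\<lambda>t. (norm (s N t))\<^sup>2)" for N
    unfolding s_def by (intro continuous_intros)
  from uniform_limit_integral_cbox[OF u2 this] obtain I J where
    I: "\<And>N. ((\<lambda>t. (norm (s N t))\<^sup>2) has_integral I N) (cbox 0 (2*pi))"
    and J: "((\<lambda>t. (norm (G (of_real r * exp (\<i> * of_real t))))\<^sup>2) has_integral J) (cbox 0 (2*pi))"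
    and IJ: "I \<longlonglongrightarrow> J" by auto
  have "I N = 2 * pi * (\<Sum>n<N. (norm (c n))\<^sup>2)" for N
    using has_integral_unique[OF I] parseval_finite[where c = c and N = N] by (simp add: s_def)
  then have "(\<lambda>N. (2 * pi * (\<Sum>n<N. (norm (c n))\<^sup>2)) / (2 * pi)) \<longlonglongrightarrow> J / (2 * pi)"
    using tendsto_divide[OF IJ tendsto_const, of "2 * pi"] by simp
  then have "(\<lambda>n. (norm (c n))\<^sup>2) sums (J / (2*pi))"
    by (simp add: sums_def)
  moreover have "integral_mean_pow 2 r G = J / (2*pi)"
    unfolding integral_mean_pow_def using J by (simp add: powr_numeral integral_unique has_integral_divide)
  ultimately show ?thesis
    using r by (simp add: c_def norm_mult norm_power power_mult_distrib power_mult power2_eq_square mult_ac)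
qed

section \<open>The moments of the radial weight\<close>

text \<open>The density \<open>2 n r\<^sup>2\<^sup>n\<^sup>-\<^sup>1 (1 - r\<^sup>2)\<^sup>\<alpha>\<^sup>-\<^sup>1\<close> is the derivative of
  the \<open>n\<close>-th Parseval term \<open>r\<^sup>2\<^sup>n\<close> times the weight. For \<open>n = 0\<close> it vanishes; there the truncated
  subtraction in the exponent is harmless because of the factor \<open>n\<close>.\<close>

definition moment_density :: "real \<Rightarrow> nat \<Rightarrow> real \<Rightarrow> real"
  where "moment_density \<alpha> n r = 2 * n * r ^ (2 * n - 1) * (1 - r\<^sup>2) powr (\<alpha> - 1)"

text \<open>The coefficient of \<open>|a\<^sub>n|\<^sup>2\<close> in the norm truncated at radius \<open>R\<close>. The value \<open>1\<close> at \<open>n = 0\<close>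
  accounts for the term \<open>|f(0)|\<^sup>p\<close>, which the integral of the derivative does not see.\<close>

definition moment :: "real \<Rightarrow> nat \<Rightarrow> real \<Rightarrow> real"
  where "moment \<alpha> n R = (if n = 0 then 1 else integral {0..R} (moment_density \<alpha> n))"

lemma moment_density_nonneg: "0 \<le> r \<Longrightarrow> 0 \<le> moment_density \<alpha> n r"
  by (simp add: moment_density_def)

text \<open>The recursion \<open>c\<^sub>n\<^sub>+\<^sub>1 = c\<^sub>n (n + 1) / (n + \<alpha>)\<close> for the full moments comes from integrating the
  derivative of \<open>r\<^sup>2\<^sup>n (1 - r\<^sup>2)\<^sup>\<alpha>\<close>, which vanishes at both ends of the unit interval.\<close>

lemma has_integral_moment_density:
  assumes "0 < \<alpha>"
  shows "(moment_density \<alpha> (Suc n) has_integral (fact (Suc n) / pochhammer \<alpha> (Suc n))) {0..1}"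
proof (induction n)
  case 0
  have "(moment_density \<alpha> 1 has_integral (- ((1 - 1\<^sup>2) powr \<alpha> / \<alpha>) - (- ((1 - 0\<^sup>2) powr \<alpha> / \<alpha>)))) {0..1}"
  proof (rule fundamental_theorem_of_calculus_interior)
    show "continuous_on {0..1} (\<lambda>r. - ((1 - r\<^sup>2) powr \<alpha> / \<alpha>))"
      using assms by (intro continuous_intros continuous_on_powr') (auto simp: power_le_one)
    show "((\<lambda>r. - ((1 - r\<^sup>2) powr \<alpha> / \<alpha>)) has_vector_derivative moment_density \<alpha> 1 r) (at r)"
      if "r \<in> {0<..<1}" for r :: real
    proof -
      have "r\<^sup>2 < 1" using that by (simp add: power_less_one_iff)
      then show ?thesis
        using assms unfolding has_real_derivative_iff_has_vector_derivative[symmetric]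
        by (auto intro!: derivative_eq_intros simp: moment_density_def)
    qed
  qed simp
  then show ?case using assms by simp
next
  case (Suc n)
  let ?m = "Suc n"
  have "((\<lambda>r. moment_density \<alpha> ?m r - (\<alpha> + ?m) / (?m + 1) * moment_density \<alpha> (Suc ?m) r) has_integral
      (1 ^ (2 * ?m) * (1 - 1\<^sup>2) powr \<alpha> - 0 ^ (2 * ?m) * (1 - 0\<^sup>2) powr \<alpha>)) {0..1}"
  proof (rule fundamental_theorem_of_calculus_interior)
    show "continuous_on {0..1} (\<lambda>r::real. r ^ (2 * ?m) * (1 - r\<^sup>2) powr \<alpha>)"
      using assms by (intro continuous_intros continuous_on_powr') (auto simp: power_le_one)
    show "((\<lambda>r. r ^ (2 * ?m) * (1 - r\<^sup>2) powr \<alpha>) has_vector_derivative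
        moment_density \<alpha> ?m r - (\<alpha> + ?m) / (?m + 1) * moment_density \<alpha> (Suc ?m) r) (at r)"
      if "r \<in> {0<..<1}" for r :: real
    proof -
      have r: "r\<^sup>2 < 1" using that by (simp add: power_less_one_iff)
      have "((\<lambda>r. r ^ (2 * ?m) * (1 - r\<^sup>2) powr \<alpha>) has_real_derivative
         2 * ?m * r ^ (2 * ?m - 1) * (1 - r\<^sup>2) powr \<alpha> + r ^ (2 * ?m) * (\<alpha> * (1 - r\<^sup>2) powr (\<alpha> - 1) * (- 2 * r))) (at r)"
      proof -
        have 1: "((\<lambda>r. r ^ (2 * ?m)) has_real_derivative real (2 * ?m) * r ^ (2 * ?m - Suc 0)) (at r)"
          by (rule DERIV_pow)
        have 2: "((\<lambda>r. (1 - r\<^sup>2) powr \<alpha>) has_real_derivative \<alpha> * (1 - r\<^sup>2) powr (\<alpha> - 1) * (- 2 * r)) (at r)"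
          using r by (auto intro!: derivative_eq_intros)
        from DERIV_mult[OF 1 2] show ?thesis
          by (simp add: add.commute mult.commute)
      qed
      moreover have "(1 - r\<^sup>2) powr \<alpha> = (1 - r\<^sup>2) * (1 - r\<^sup>2) powr (\<alpha> - 1)"
        using r by (simp add: powr_diff)
      ultimately have "((\<lambda>r. r ^ (2 * ?m) * (1 - r\<^sup>2) powr \<alpha>) has_real_derivative
         2 * ?m * r ^ (2 * ?m - 1) * ((1 - r\<^sup>2) * (1 - r\<^sup>2) powr (\<alpha> - 1)) + r ^ (2 * ?m) * (\<alpha> * (1 - r\<^sup>2) powr (\<alpha> - 1) * (- 2 * r))) (at r)"
        by simp
      also have "2 * ?m * r ^ (2 * ?m - 1) * ((1 - r\<^sup>2) * (1 - r\<^sup>2) powr (\<alpha> - 1)) + r ^ (2 * ?m) * (\<alpha> * (1 - r\<^sup>2) powr (\<alpha> - 1) * (- 2 * r))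
        = moment_density \<alpha> ?m r - (\<alpha> + ?m) / (?m + 1) * moment_density \<alpha> (Suc ?m) r"
        using \<open>r \<in> _\<close> by (simp add: moment_density_def power2_eq_square divide_simps) (simp add: algebra_simps)
      finally show ?thesis
        by (simp add: has_real_derivative_iff_has_vector_derivative)
    qed
  qed simp
  then have 1: "((\<lambda>r. moment_density \<alpha> ?m r - (\<alpha> + ?m) / (?m + 1) * moment_density \<alpha> (Suc ?m) r) has_integral 0) {0..1}"
    by simp
  have "((\<lambda>r. (?m + 1) / (\<alpha> + ?m) * (moment_density \<alpha> ?m r - (moment_density \<alpha> ?m r - (\<alpha> + ?m) / (?m + 1) * moment_density \<alpha> (Suc ?m) r)))
     has_integral ((?m + 1) / (\<alpha> + ?m) * (fact ?m / pochhammer \<alpha> ?m - 0))) {0..1}"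
    by (intro has_integral_mult_right has_integral_diff Suc 1)
  also have "(\<lambda>r. (?m + 1) / (\<alpha> + ?m) * (moment_density \<alpha> ?m r - (moment_density \<alpha> ?m r - (\<alpha> + ?m) / (?m + 1) * moment_density \<alpha> (Suc ?m) r)))
     = moment_density \<alpha> (Suc ?m)"
    using assms by (auto simp: fun_eq_iff divide_simps)
  also have "(?m + 1) / (\<alpha> + ?m) * (fact ?m / pochhammer \<alpha> ?m - 0) = fact (Suc ?m) / pochhammer \<alpha> (Suc ?m)"
    by (simp add: pochhammer_Suc[of \<alpha> "Suc n"] algebra_simps del: pochhammer_Suc)
  finally show ?case .
qed

lemma moment_1: "0 < \<alpha> \<Longrightarrow> moment \<alpha> n 1 = fact n / pochhammer \<alpha> n"
  using has_integral_moment_density[of \<alpha> "n - 1"]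
  by (cases n) (auto simp: moment_def intro!: integral_unique)

lemma moment_density_integrable:
  assumes "0 < \<alpha>" "R \<le> 1"
  shows "moment_density \<alpha> n integrable_on {0..R}"
proof (cases n)
  case 0
  then show ?thesis by (simp add: moment_density_def[abs_def] integrable_0)
next
  case (Suc m)
  then have "moment_density \<alpha> n integrable_on {0..1}"
    using has_integral_moment_density[OF assms(1), of m] by auto
  then show ?thesis
    by (rule integrable_on_subinterval) (use assms in auto)
qed

lemma continuous_on_moment:
  assumes "0 < \<alpha>"
  shows "continuous_on {0..1} (moment \<alpha> n)"
proof (cases "n = 0")
  case False
  have "continuous_on {0..1} (\<lambda>R. integral {0..R} (moment_density \<alpha> n))"
    by (rule indefinite_integral_continuous_1) (simp add: moment_density_integrable assms)
  then show ?thesis using False by (simp add: moment_def[abs_def])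
qed (simp add: moment_def[abs_def])

text \<open>For \<open>\<alpha> \<le> 1\<close> the weight is at least \<open>1\<close>, so that a truncated moment dominates the one without weight.
  The radius \<open>R = 1\<close> is excluded because \<open>0 powr (\<alpha> - 1) = 0\<close>.\<close>

lemma moment_ge_power:
  assumes "0 < \<alpha>" "\<alpha> \<le> 1" "0 \<le> R" "R < 1"
  shows "R ^ (2 * n) \<le> moment \<alpha> n R"
proof (cases n)
  case (Suc m)
  have "((\<lambda>r. 2 * n * r ^ (2 * n - 1)) has_integral R ^ (2 * n) - 0 ^ (2 * n)) {0..R}"
    by (rule fundamental_theorem_of_calculus)
       (use assms in \<open>auto intro!: derivative_eq_intros simp flip: has_real_derivative_iff_has_vector_derivative\<close>)
  moreover have "(moment_density \<alpha> n has_integral moment \<alpha> n R) {0..R}"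
    using moment_density_integrable[of \<alpha> R n] assms Suc by (simp add: moment_def has_integral_integral)
  moreover have "2 * n * r ^ (2 * n - 1) \<le> moment_density \<alpha> n r" if "r \<in> {0..R}" for r :: real
  proof -
    have "r\<^sup>2 < 1" using that assms by (simp add: power_less_one_iff)
    then have "1 \<le> (1 - r\<^sup>2) powr (\<alpha> - 1)"
      using powr_mono2'[of "\<alpha> - 1" "1 - r\<^sup>2" 1] assms by simp
    then show ?thesis
      unfolding moment_density_def using that
      using mult_left_mono[of 1 "(1 - r\<^sup>2) powr (\<alpha> - 1)" "2 * n * r ^ (2 * n - 1)"] by simp
  qed
  ultimately have "R ^ (2 * n) - 0 ^ (2 * n) \<le> moment \<alpha> n R"
    by - (rule has_integral_le)
  then show ?thesis using Suc by simp
qed (simp add: moment_def)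

text \<open>The reciprocals of the moments are the coefficients of the reproducing kernel.\<close>

lemma inverse_moment_sums:
  fixes z :: complex
  assumes "0 < \<alpha>" "norm z < 1"
  shows "(\<lambda>n. z ^ n / of_real (moment \<alpha> n 1)) sums (1 - z) powr (- of_real \<alpha>)"
proof -
  have "(\<lambda>n. (- of_real \<alpha> gchoose n) * (- z) ^ n) sums (1 + (- z)) powr (- of_real \<alpha>)"
    by (rule gen_binomial_complex) (use assms in simp)
  also have "(\<lambda>n. (- of_real \<alpha> gchoose n) * (- z) ^ n) = (\<lambda>n. z ^ n / of_real (moment \<alpha> n 1))"
  proof
    fix n
    have "(- of_real \<alpha> gchoose n) * (- z) ^ n = ((- 1) ^ n * (- 1) ^ n) * (pochhammer (of_real \<alpha>) n / fact n * z ^ n)"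
      unfolding gbinomial_pochhammer power_minus[of z] by simp
    also have "\<dots> = z ^ n / of_real (moment \<alpha> n 1)"
      using assms by (simp add: moment_1 pochhammer_of_real flip: power_mult_distrib)
    finally show "(- of_real \<alpha> gchoose n) * (- z) ^ n = z ^ n / of_real (moment \<alpha> n 1)" .
  qed
  finally show ?thesis by simp
qed

section \<open>The Cauchy-Schwarz inequality in a weighted sequence space\<close>

text \<open>The difference of the two sides of the Cauchy-Schwarz inequality, written as a sum of squares:
  it yields the inequality and its equality case together.\<close>

lemma weighted_l2_defect:
  fixes a :: "nat \<Rightarrow> complex" and c :: "nat \<Rightarrow> real" and w g :: complex
  assumes c: "\<And>n. 0 < c n"
    and S: "summable (\<lambda>n. (norm (a n))\<^sup>2 * c n)"
    and K: "(\<lambda>n. (norm w) ^ (2 * n) / c n) sums K"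
    and g: "(\<lambda>n. a n * w ^ n) sums g"
  shows "(\<lambda>n. c n * (norm (a n - g / K * cnj w ^ n / c n))\<^sup>2) sums
           ((\<Sum>n. (norm (a n))\<^sup>2 * c n) - (norm g)\<^sup>2 / K)"
    and "0 < K"
proof -
  have "0 < (norm w) ^ (2 * 0) / c 0" using c by simp
  also have "\<dots> \<le> K"
    using sum_le_suminf[of "\<lambda>n. (norm w) ^ (2 * n) / c n" "{0}"] K c
    by (auto simp: sums_iff less_imp_le)
  finally show "0 < K" .
  have term_eq: "c n * (norm (a n - g / K * cnj w ^ n / c n))\<^sup>2 =
      (norm (a n))\<^sup>2 * c n - 2 / K * Re (cnj g * (a n * w ^ n)) + (norm g)\<^sup>2 / K\<^sup>2 * ((norm w) ^ (2 * n) / c n)" for n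
  proof -
    have "(norm (x - y))\<^sup>2 = (norm x)\<^sup>2 - 2 * Re (cnj y * x) + (norm y)\<^sup>2" for x y :: complex
      by (simp add: cmod_power2) (simp add: power2_eq_square algebra_simps)
    then have "(norm (a n - g / K * cnj w ^ n / c n))\<^sup>2 =
       (norm (a n))\<^sup>2 - 2 * Re (cnj (g / K * cnj w ^ n / c n) * a n) + (norm (g / K * cnj w ^ n / c n))\<^sup>2"
      by blast
    also have "cnj (g / K * cnj w ^ n / c n) * a n = of_real (1 / (K * c n)) * (cnj g * (a n * w ^ n))"
      by (simp add: field_simps)
    also have "Re \<dots> = 1 / (K * c n) * Re (cnj g * (a n * w ^ n))"
    proof -
      have "Re (of_real r * z) = r * Re z" for r z by simp
      then show ?thesis .
    qed
    also have "(norm (g / K * cnj w ^ n / c n))\<^sup>2 = (norm g)\<^sup>2 / K\<^sup>2 * ((norm w) ^ (2 * n) / (c n)\<^sup>2)"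
      by (simp add: norm_mult norm_divide norm_power power_mult_distrib power_divide power_mult[symmetric] mult.commute)
    finally have "c n * (norm (a n - g / K * cnj w ^ n / c n))\<^sup>2 =
        c n * ((norm (a n))\<^sup>2 - 2 * (1 / (K * c n) * Re (cnj g * (a n * w ^ n)))
          + (norm g)\<^sup>2 / K\<^sup>2 * ((norm w) ^ (2 * n) / (c n)\<^sup>2))"
      by simp
    also have "C * (A - 2 * (1 / (K * C) * X) + G * (W / C\<^sup>2)) = A * C - 2 / K * X + G * (W / C)"
      if "C \<noteq> 0" for C A X G W :: real
      using that \<open>0 < K\<close> by (simp add: divide_simps power2_eq_square)
    finally show ?thesis using c[of n] by simp
  qed
  have "(\<lambda>n. Re (cnj g * (a n * w ^ n))) sums Re (cnj g * g)"
    by (intro sums_Re sums_mult g)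
  also have "Re (cnj g * g) = (norm g)\<^sup>2"
    by (simp add: cmod_power2 mult.commute[of "cnj g"] complex_mult_cnj)
  finally have "(\<lambda>n. (norm (a n))\<^sup>2 * c n - 2 / K * Re (cnj g * (a n * w ^ n)) + (norm g)\<^sup>2 / K\<^sup>2 * ((norm w) ^ (2 * n) / c n))
      sums ((\<Sum>n. (norm (a n))\<^sup>2 * c n) - 2 / K * (norm g)\<^sup>2 + (norm g)\<^sup>2 / K\<^sup>2 * K)"
    by (intro sums_add sums_diff sums_mult K summable_sums S)
  also have "(\<Sum>n. (norm (a n))\<^sup>2 * c n) - 2 / K * (norm g)\<^sup>2 + (norm g)\<^sup>2 / K\<^sup>2 * K
      = (\<Sum>n. (norm (a n))\<^sup>2 * c n) - (norm g)\<^sup>2 / K"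
    using \<open>0 < K\<close> by (simp add: field_simps power2_eq_square)
  finally show "(\<lambda>n. c n * (norm (a n - g / K * cnj w ^ n / c n))\<^sup>2) sums
           ((\<Sum>n. (norm (a n))\<^sup>2 * c n) - (norm g)\<^sup>2 / K)"
    unfolding term_eq .
qed

lemma weighted_l2_bound:
  fixes a :: "nat \<Rightarrow> complex" and c :: "nat \<Rightarrow> real" and w g :: complex
  assumes c: "\<And>n. 0 < c n"
    and K: "(\<lambda>n. (norm w) ^ (2 * n) / c n) sums K"
    and g: "(\<lambda>n. a n * w ^ n) sums g"
  shows "ennreal ((norm g)\<^sup>2 / K) \<le> (\<Sum>n. ennreal ((norm (a n))\<^sup>2 * c n))"
proof (cases "summable (\<lambda>n. (norm (a n))\<^sup>2 * c n)")
  case True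
  note D = weighted_l2_defect[OF c True K g]
  have "0 \<le> (\<Sum>n. (norm (a n))\<^sup>2 * c n) - (norm g)\<^sup>2 / K"
    by (rule sums_le[OF _ sums_zero D(1)]) (simp add: c less_imp_le)
  then have "ennreal ((norm g)\<^sup>2 / K) \<le> ennreal (\<Sum>n. (norm (a n))\<^sup>2 * c n)"
    by (intro ennreal_leI) simp
  also have "\<dots> = (\<Sum>n. ennreal ((norm (a n))\<^sup>2 * c n))"
    using True by (intro suminf_ennreal2[symmetric]) (auto simp: c less_imp_le)
  finally show ?thesis .
next
  case False
  have nonneg: "0 \<le> (norm (a i))\<^sup>2 * c i" for i using c[of i] by simp
  have "(\<Sum>n. ennreal ((norm (a n))\<^sup>2 * c n)) = top"
    using summable_suminf_not_top[of "\<lambda>n. (norm (a n))\<^sup>2 * c n", OF nonneg] False by blast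
  then show ?thesis by simp
qed

lemma weighted_l2_equality:
  fixes a :: "nat \<Rightarrow> complex" and c :: "nat \<Rightarrow> real" and w g :: complex
  assumes c: "\<And>n. 0 < c n"
    and K: "(\<lambda>n. (norm w) ^ (2 * n) / c n) sums K"
    and g: "(\<lambda>n. a n * w ^ n) sums g"
    and eq: "ennreal ((norm g)\<^sup>2 / K) = (\<Sum>n. ennreal ((norm (a n))\<^sup>2 * c n))"
  shows "a n = g / K * cnj w ^ n / c n"
proof -
  have S: "summable (\<lambda>n. (norm (a n))\<^sup>2 * c n)"
  proof (rule summable_suminf_not_top)
    show "0 \<le> (norm (a i))\<^sup>2 * c i" for i using c[of i] by simp
    show "(\<Sum>n. ennreal ((norm (a n))\<^sup>2 * c n)) \<noteq> top" unfolding eq[symmetric] by simp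
  qed
  note D = weighted_l2_defect[OF c S K g]
  have "ennreal ((norm g)\<^sup>2 / K) = ennreal (\<Sum>n. (norm (a n))\<^sup>2 * c n)"
    unfolding eq using S by (intro suminf_ennreal2) (auto simp: c less_imp_le)
  then have "(norm g)\<^sup>2 / K = (\<Sum>n. (norm (a n))\<^sup>2 * c n)"
    using D(2) by (subst (asm) ennreal_inj) (auto intro!: suminf_nonneg S simp: c less_imp_le)
  with D(1) have "(\<lambda>n. c n * (norm (a n - g / K * cnj w ^ n / c n))\<^sup>2) sums 0" by simp
  then have "(\<Sum>n. c n * (norm (a n - g / K * cnj w ^ n / c n))\<^sup>2) = 0"
    and "summable (\<lambda>n. c n * (norm (a n - g / K * cnj w ^ n / c n))\<^sup>2)"
    by (simp_all only: sums_iff)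
  moreover have "0 \<le> c n * (norm (a n - g / K * cnj w ^ n / c n))\<^sup>2" for n
    using c[of n] by simp
  ultimately have "c n * (norm (a n - g / K * cnj w ^ n / c n))\<^sup>2 = 0"
    by (subst (asm) suminf_eq_zero_iff) blast+
  then show ?thesis using c[of n] by simp
qed

section \<open>The norm of a zero-free function\<close>

text \<open>Parseval's formula differentiated term by term, as a power series in \<open>r\<^sup>2\<close>.\<close>

lemma mean_square_deriv_sums:
  assumes G: "\<And>z. norm z < \<rho> \<Longrightarrow> (\<lambda>n. a n * z ^ n) sums G z" and r: "0 < r" "r < \<rho>"
  shows "(\<lambda>n. (norm (a n))\<^sup>2 * moment_density \<alpha> n r) sums
    (deriv (\<lambda>s. integral_mean_pow 2 s G) r * (1 - r\<^sup>2) powr (\<alpha> - 1))"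
proof -
  define b where "b n = (norm (a n))\<^sup>2" for n
  define H where "H x = (\<Sum>n. b n * x ^ n)" for x :: real
  have M: "(\<lambda>n. b n * (s\<^sup>2) ^ n) sums integral_mean_pow 2 s G" if "0 \<le> s" "s < \<rho>" for s
    using parseval_circle[OF G that] by (simp add: b_def power_mult)
  obtain r' where r': "r < r'" "r' < \<rho>" using r dense by blast
  have summ: "summable (\<lambda>n. b n * (r'\<^sup>2) ^ n)"
    using M[of r'] r r' by (auto simp: sums_iff)
  have lt: "norm (r\<^sup>2) < norm (r'\<^sup>2)"
    using r r' by (simp add: power_strict_mono)
  have DH: "(H has_real_derivative (\<Sum>n. diffs b n * (r\<^sup>2) ^ n)) (at (r\<^sup>2))"
    unfolding H_def[abs_def] by (rule termdiffs_strong[OF summ lt])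
  have "((\<lambda>s. H (s\<^sup>2)) has_real_derivative (\<Sum>n. diffs b n * (r\<^sup>2) ^ n) * (2 * r)) (at r)"
    by (rule DERIV_chain2[where f = H and g = "\<lambda>s. s\<^sup>2", OF DH]) (auto intro!: derivative_eq_intros)
  then have "((\<lambda>s. integral_mean_pow 2 s G) has_real_derivative (\<Sum>n. diffs b n * (r\<^sup>2) ^ n) * (2 * r)) (at r)"
  proof (rule has_field_derivative_transform_within_open)
    show "H (s\<^sup>2) = integral_mean_pow 2 s G" if "s \<in> {0<..<\<rho>}" for s
      using M[of s] that by (simp add: H_def sums_iff)
  qed (use r in auto)
  then have der: "deriv (\<lambda>s. integral_mean_pow 2 s G) r = (\<Sum>n. diffs b n * (r\<^sup>2) ^ n) * (2 * r)"
    by (rule DERIV_imp_deriv)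
  have "summable (\<lambda>n. diffs b n * (r\<^sup>2) ^ n)"
  proof (rule termdiff_converges)
    show "norm (r\<^sup>2) < norm (r'\<^sup>2)" by (rule lt)
    show "summable (\<lambda>n. b n * x ^ n)" if "norm x < norm (r'\<^sup>2)" for x
      by (rule powser_inside[OF summ that])
  qed
  then have "(\<lambda>n. diffs b n * (r\<^sup>2) ^ n * (2 * r * (1 - r\<^sup>2) powr (\<alpha> - 1))) sums
      ((\<Sum>n. diffs b n * (r\<^sup>2) ^ n) * (2 * r * (1 - r\<^sup>2) powr (\<alpha> - 1)))"
    by (intro sums_mult2 summable_sums)
  also have "(\<lambda>n. diffs b n * (r\<^sup>2) ^ n * (2 * r * (1 - r\<^sup>2) powr (\<alpha> - 1))) =
      (\<lambda>n. b (Suc n) * moment_density \<alpha> (Suc n) r)"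
    by (simp add: fun_eq_iff diffs_def moment_density_def power_mult[symmetric] mult_ac)
  finally show ?thesis
    using sums_Suc_iff[of "\<lambda>n. b n * moment_density \<alpha> n r"]
    by (simp add: der moment_density_def mult_ac flip: b_def)
qed

lemma energy_square_eq:
  assumes G: "\<And>z. norm z < \<rho> \<Longrightarrow> (\<lambda>n. a n * z ^ n) sums G z" and R: "0 < R" "R \<le> \<rho>" "R \<le> 1" and \<alpha>: "0 < \<alpha>"
  shows "ennreal ((norm (G 0))\<^sup>2) +
      (\<integral>\<^sup>+r\<in>{0<..<R}. ennreal (deriv (\<lambda>s. integral_mean_pow 2 s G) r * (1 - r\<^sup>2) powr (\<alpha> - 1)) \<partial>lborel) =
    (\<Sum>n. ennreal ((norm (a n))\<^sup>2 * moment \<alpha> n R))"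
proof -
  define b where "b n = (norm (a n))\<^sup>2" for n
  have b0: "0 \<le> b n" for n by (simp add: b_def)
  let ?I = "\<integral>\<^sup>+r\<in>{0<..<R}. ennreal (deriv (\<lambda>s. integral_mean_pow 2 s G) r * (1 - r\<^sup>2) powr (\<alpha> - 1)) \<partial>lborel"
  \<comment> \<open>all terms are nonnegative, so summation and integration may be exchanged without convergence assumptions\<close>
  have "?I = (\<integral>\<^sup>+r. (\<Sum>n. ennreal (b n * moment_density \<alpha> n r) * indicator {0<..<R} r) \<partial>lborel)"
  proof (rule nn_integral_cong)
    fix r :: real
    show "ennreal (deriv (\<lambda>s. integral_mean_pow 2 s G) r * (1 - r\<^sup>2) powr (\<alpha> - 1)) * indicator {0<..<R} r =
        (\<Sum>n. ennreal (b n * moment_density \<alpha> n r) * indicator {0<..<R} r)"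
    proof (cases "r \<in> {0<..<R}")
      case True
      then have "(\<lambda>n. b n * moment_density \<alpha> n r) sums
         (deriv (\<lambda>s. integral_mean_pow 2 s G) r * (1 - r\<^sup>2) powr (\<alpha> - 1))"
        unfolding b_def using R by (intro mean_square_deriv_sums[OF G]) auto
      then have "ennreal (deriv (\<lambda>s. integral_mean_pow 2 s G) r * (1 - r\<^sup>2) powr (\<alpha> - 1)) =
          (\<Sum>n. ennreal (b n * moment_density \<alpha> n r))"
        using True by (subst suminf_ennreal2) (auto simp: sums_iff b0 moment_density_nonneg)
      then show ?thesis using True by simp
    qed simp
  qed
  also have "\<dots> = (\<Sum>n. \<integral>\<^sup>+r. ennreal (b n * moment_density \<alpha> n r) * indicator {0<..<R} r \<partial>lborel)"
    unfolding moment_density_def by (rule nn_integral_suminf) measurable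
  also have "\<dots> = (\<Sum>n. ennreal (b n * (if n = 0 then 0 else moment \<alpha> n R)))"
  proof (rule suminf_cong)
    fix n
    have "(moment_density \<alpha> n has_integral (if n = 0 then 0 else moment \<alpha> n R)) {0..R}"
      using moment_density_integrable[OF \<alpha> R(3), of n]
      by (auto simp: moment_def has_integral_integral moment_density_def[abs_def] has_integral_0)
    then have "((\<lambda>r. b n * moment_density \<alpha> n r) has_integral (b n * (if n = 0 then 0 else moment \<alpha> n R))) {0<..<R}"
      unfolding has_integral_Icc_iff_Ioo[symmetric] by (rule has_integral_mult_right)
    from nn_integral_has_integral_lebesgue'[OF _ this]
    show "(\<integral>\<^sup>+r. ennreal (b n * moment_density \<alpha> n r) * indicator {0<..<R} r \<partial>lborel) =
        ennreal (b n * (if n = 0 then 0 else moment \<alpha> n R))"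
      by (simp add: b0 moment_density_nonneg)
  qed
  finally have I: "?I = (\<Sum>n. ennreal (b n * (if n = 0 then 0 else moment \<alpha> n R)))" .
  have "ennreal ((norm (G 0))\<^sup>2) = (\<Sum>n. if n = 0 then ennreal (b 0) else 0)"
  proof -
    have "G 0 = a 0"
      using G[of 0] R powser_sums_zero[of a] by (auto intro: sums_unique2)
    then show ?thesis
      using sums_single[of 0 "\<lambda>_. ennreal (b 0)"] by (simp add: sums_iff b_def)
  qed
  with I have "ennreal ((norm (G 0))\<^sup>2) + ?I =
      (\<Sum>n. if n = 0 then ennreal (b 0) else 0) + (\<Sum>n. ennreal (b n * (if n = 0 then 0 else moment \<alpha> n R)))"
    by simp
  also have "(\<Sum>n. if n = 0 then ennreal (b 0) else 0) + (\<Sum>n. ennreal (b n * (if n = 0 then 0 else moment \<alpha> n R))) =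
     (\<Sum>n. (if n = 0 then ennreal (b 0) else 0) + ennreal (b n * (if n = 0 then 0 else moment \<alpha> n R)))"
    by (rule suminf_add) auto
  also have "\<dots> = (\<Sum>n. ennreal (b n * moment \<alpha> n R))"
    by (intro suminf_cong) (auto simp: moment_def)
  finally show ?thesis by (simp add: b_def)
qed

text \<open>The expression that defines the norm, with the radial integral stopped at the radius \<open>R\<close>; for
  \<open>R = 1\<close> it is the \<open>p\<close>-th power of the norm. Like the norm, it takes the value infinity where the integral diverges.\<close>

definition radial_energy :: "real \<Rightarrow> real \<Rightarrow> real \<Rightarrow> (complex \<Rightarrow> complex) \<Rightarrow> ennreal"
  where "radial_energy \<alpha> p R f = ennreal (norm (f 0) powr p) +
    (\<integral>\<^sup>+r\<in>{0<..<R}. ennreal (deriv (\<lambda>s. integral_mean_pow p s f) r * (1 - r\<^sup>2) powr (\<alpha> - 1)) \<partial>lborel)"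

lemma wnorm_pow_eq_radial_energy: "wnorm_pow \<alpha> p f = radial_energy \<alpha> p 1 f"
  by (simp add: wnorm_pow_def radial_energy_def)

lemma radial_energy_mono: "R \<le> S \<Longrightarrow> radial_energy \<alpha> p R f \<le> radial_energy \<alpha> p S f"
  unfolding radial_energy_def by (intro add_left_mono nn_integral_mono) (auto simp: indicator_def)

lemma integral_mean_pow_cong:
  assumes "\<And>z. norm z = \<bar>r\<bar> \<Longrightarrow> norm (f z) powr p = norm (g z) powr q"
  shows "integral_mean_pow p r f = integral_mean_pow q r g"
  unfolding integral_mean_pow_def using assms by (simp add: norm_mult)

lemma radial_energy_cong:
  assumes R: "0 < R" "R \<le> \<rho>"
    and eq: "\<And>z. z \<in> ball 0 \<rho> \<Longrightarrow> norm (f z) powr p = norm (g z) powr q"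
  shows "radial_energy \<alpha> p R f = radial_energy \<alpha> q R g"
proof -
  have "deriv (\<lambda>s. integral_mean_pow p s f) r = deriv (\<lambda>s. integral_mean_pow q s g) r"
    if "r \<in> {0<..<R}" for r
  proof (rule deriv_cong_ev)
    have "eventually (\<lambda>s. s \<in> {0<..<R}) (nhds r)"
      using that by (intro eventually_nhds_in_open) auto
    then show "\<forall>\<^sub>F s in nhds r. integral_mean_pow p s f = integral_mean_pow q s g"
      by eventually_elim (rule integral_mean_pow_cong, use R eq in auto)
  qed simp
  then show ?thesis
    unfolding radial_energy_def using eq[of 0] R
    by (auto intro!: arg_cong2[of _ _ _ _ "(+)"] nn_integral_cong simp: indicator_def)
qed

lemma norm_powr_of_real:
  fixes z :: complex
  assumes "z \<noteq> 0"
  shows "norm (z powr of_real a) = norm z powr a"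
  using assms by (simp add: powr_def)

lemma Re_kernel_pos:
  fixes w z :: complex
  assumes "norm w < 1" "norm z < 1"
  shows "0 < Re (1 - cnj w * z)" "1 - cnj w * z \<noteq> 0"
proof -
  have "norm (cnj w * z) < 1"
    using assms norm_mult_less[of "cnj w" 1 z 1] by simp
  then show "0 < Re (1 - cnj w * z)"
    using complex_Re_le_cmod[of "cnj w * z"] by simp
  then show "1 - cnj w * z \<noteq> 0" by force
qed

lemma kernel_powr_holomorphic:
  assumes "norm w < 1"
  shows "(\<lambda>z. (1 - cnj w * z) powr a) holomorphic_on ball 0 1"
proof (intro holomorphic_intros)
  fix z :: complex assume "z \<in> ball 0 1"
  then have "0 < Re (1 - cnj w * z)" using assms Re_kernel_pos by auto
  then show "1 - cnj w * z \<notin> \<real>\<^sub>\<le>\<^sub>0"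
    by (auto simp: complex_nonpos_Reals_iff)
qed

text \<open>The function \<open>G\<close> is a branch of \<open>f\<^sup>p\<^sup>/\<^sup>2\<close>, which exists because \<open>f\<close> has a logarithm.\<close>

lemma zero_free_square:
  assumes hol: "f holomorphic_on ball 0 \<rho>" and nz: "\<And>z. z \<in> ball 0 \<rho> \<Longrightarrow> f z \<noteq> 0" and "0 < \<rho>"
  obtains G where "G holomorphic_on ball 0 \<rho>"
    and "\<And>z. z \<in> ball 0 \<rho> \<Longrightarrow> norm (f z) powr p = (norm (G z))\<^sup>2"
proof -
  obtain g where g: "g holomorphic_on ball 0 \<rho>" "\<And>z. z \<in> ball 0 \<rho> \<Longrightarrow> exp (g z) = f z"
    using holomorphic_logarithm_exists[OF convex_ball open_ball hol nz, of 0] \<open>0 < \<rho>\<close> by auto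
  show thesis
  proof
    show "(\<lambda>z. exp (of_real (p / 2) * g z)) holomorphic_on ball 0 \<rho>"
      by (intro holomorphic_intros g)
    fix z :: complex assume "z \<in> ball 0 \<rho>"
    then have "norm (f z) powr p = exp (p * Re (g z))"
      using g(2)[of z, symmetric] by (simp add: powr_def)
    also have "\<dots> = (norm (exp (of_real (p / 2) * g z)))\<^sup>2"
      by (simp add: power2_eq_square flip: exp_add)
    finally show "norm (f z) powr p = (norm (exp (of_real (p / 2) * g z)))\<^sup>2" .
  qed
qed

lemma radial_energy_square:
  assumes G: "\<And>z. norm z < \<rho> \<Longrightarrow> (\<lambda>n. a n * z ^ n) sums G z"
    and R: "0 < R" "R \<le> \<rho>" "R \<le> 1" and \<alpha>: "0 < \<alpha>"
    and eq: "\<And>z. z \<in> ball 0 \<rho> \<Longrightarrow> norm (f z) powr p = (norm (G z))\<^sup>2"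
  shows "radial_energy \<alpha> p R f = (\<Sum>n. ennreal ((norm (a n))\<^sup>2 * moment \<alpha> n R))"
proof -
  have "radial_energy \<alpha> p R f = radial_energy \<alpha> 2 R G"
    by (rule radial_energy_cong[OF R(1,2)]) (simp add: eq)
  also have "\<dots> = (\<Sum>n. ennreal ((norm (a n))\<^sup>2 * moment \<alpha> n R))"
    unfolding radial_energy_def using energy_square_eq[OF G R \<alpha>] by simp
  finally show ?thesis .
qed

lemma radial_energy_zero_free_ge:
  assumes hol: "f holomorphic_on ball 0 \<rho>" and nz: "\<And>z. z \<in> ball 0 \<rho> \<Longrightarrow> f z \<noteq> 0"
    and R: "0 < R" "R \<le> \<rho>" "R \<le> 1" and \<alpha>: "0 < \<alpha>" and w: "norm w < \<rho>"
    and pos: "\<And>n. 0 < moment \<alpha> n R"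
    and K: "(\<lambda>n. (norm w) ^ (2 * n) / moment \<alpha> n R) sums K"
  shows "ennreal (norm (f w) powr p / K) \<le> radial_energy \<alpha> p R f"
proof -
  obtain G where G: "G holomorphic_on ball 0 \<rho>"
    and eq: "\<And>z. z \<in> ball 0 \<rho> \<Longrightarrow> norm (f z) powr p = (norm (G z))\<^sup>2"
    using zero_free_square[OF hol nz] R by auto
  define a where "a n = (deriv ^^ n) G 0 / fact n" for n
  have a: "(\<lambda>n. a n * z ^ n) sums G z" if "norm z < \<rho>" for z
    using holomorphic_power_series[OF G, of z] that by (simp add: a_def)
  have "radial_energy \<alpha> p R f = (\<Sum>n. ennreal ((norm (a n))\<^sup>2 * moment \<alpha> n R))"
    by (rule radial_energy_square[OF a R \<alpha> eq])
  then show ?thesis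
    using weighted_l2_bound[OF pos K a[OF w]] w by (simp add: eq)
qed

lemma moment_1_pos: "0 < \<alpha> \<Longrightarrow> 0 < moment \<alpha> n 1"
  by (simp add: moment_1 pochhammer_pos)

lemma kernel_norm_sums:
  fixes w :: complex
  assumes "0 < \<alpha>" "norm w < 1"
  shows "(\<lambda>n. (norm w) ^ (2 * n) / moment \<alpha> n 1) sums (1 - (norm w)\<^sup>2) powr - \<alpha>"
proof -
  have lt: "(norm w)\<^sup>2 < 1" using assms by (simp add: power_less_one_iff)
  then have "(\<lambda>n. of_real ((norm w)\<^sup>2) ^ n / of_real (moment \<alpha> n 1)) sums (1 - of_real ((norm w)\<^sup>2)) powr (- complex_of_real \<alpha>)"
    by (intro inverse_moment_sums) (use assms in \<open>simp_all only: norm_of_real, simp\<close>)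
  also have "(1 - of_real ((norm w)\<^sup>2)) powr (- complex_of_real \<alpha>) = complex_of_real ((1 - (norm w)\<^sup>2) powr - \<alpha>)"
    using powr_of_real[of "1 - (norm w)\<^sup>2" "- \<alpha>"] lt by simp
  finally have "(\<lambda>n. complex_of_real ((norm w) ^ (2 * n) / moment \<alpha> n 1)) sums complex_of_real ((1 - (norm w)\<^sup>2) powr - \<alpha>)"
    by (simp add: power_mult)
  then show ?thesis unfolding sums_of_real_iff .
qed

lemma wnorm_pow_zero_free_ge:
  assumes hol: "f holomorphic_on ball 0 1" and nz: "\<And>z. z \<in> ball 0 1 \<Longrightarrow> f z \<noteq> 0"
    and \<alpha>: "0 < \<alpha>" and w: "norm w < 1"
  shows "ennreal (norm (f w) powr p * (1 - (norm w)\<^sup>2) powr \<alpha>) \<le> wnorm_pow \<alpha> p f"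
proof -
  have "ennreal (norm (f w) powr p / (1 - (norm w)\<^sup>2) powr - \<alpha>) \<le> wnorm_pow \<alpha> p f"
    unfolding wnorm_pow_eq_radial_energy
    by (rule radial_energy_zero_free_ge[OF hol nz _ _ _ \<alpha> w moment_1_pos kernel_norm_sums]) (use \<alpha> w in auto)
  then show ?thesis by (simp add: powr_minus_divide)
qed

lemma constant_modulus_imp_constant:
  assumes hol: "h holomorphic_on ball 0 1" and c: "\<And>z. z \<in> ball 0 1 \<Longrightarrow> norm (h z) = c"
  obtains C where "\<And>z. z \<in> ball 0 1 \<Longrightarrow> h z = C"
proof -
  have "h constant_on ball 0 1"
    by (rule maximum_modulus_principle[OF hol, of "ball 0 1" 0]) (auto simp: c)
  then show thesis using that unfolding constant_on_def by blast
qed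

text \<open>Equality identifies \<open>G = f\<^sup>p\<^sup>/\<^sup>2\<close> as a multiple of a power of the kernel. No choice of branches is
  needed to return to \<open>f\<close>: the quotient of \<open>f\<close> by the expected extremal function has constant modulus,
  hence is constant.\<close>

lemma wnorm_pow_zero_free_equality:
  assumes hol: "f holomorphic_on ball 0 1" and nz: "\<And>z. z \<in> ball 0 1 \<Longrightarrow> f z \<noteq> 0"
    and \<alpha>: "0 < \<alpha>" and p: "0 < p" and w: "norm w < 1"
    and eq: "ennreal (norm (f w) powr p * (1 - (norm w)\<^sup>2) powr \<alpha>) = wnorm_pow \<alpha> p f"
  obtains C where "\<And>z. z \<in> ball 0 1 \<Longrightarrow> f z = C * (1 - cnj w * z) powr (of_real (- 2 * \<alpha> / p))"
proof -
  obtain G where G: "G holomorphic_on ball 0 1"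
    and fG: "\<And>z. z \<in> ball 0 1 \<Longrightarrow> norm (f z) powr p = (norm (G z))\<^sup>2"
    using zero_free_square[OF hol nz] by auto
  define a where "a n = (deriv ^^ n) G 0 / fact n" for n
  have a: "(\<lambda>n. a n * z ^ n) sums G z" if "norm z < 1" for z
    using holomorphic_power_series[OF G, of z] that by (simp add: a_def)
  define K where "K = (1 - (norm w)\<^sup>2) powr - \<alpha>"
  have "ennreal ((norm (G w))\<^sup>2 / K) = (\<Sum>n. ennreal ((norm (a n))\<^sup>2 * moment \<alpha> n 1))"
    using eq radial_energy_square[where f = f and p = p and R = 1, OF a _ _ _ \<alpha> fG] w
    by (simp add: wnorm_pow_eq_radial_energy K_def powr_minus_divide fG)
  then have an: "a n = G w / K * cnj w ^ n / moment \<alpha> n 1" for n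
    by (rule weighted_l2_equality[OF moment_1_pos[OF \<alpha>] kernel_norm_sums[OF \<alpha> w, folded K_def] a[OF w]])
  have Gz: "G z = G w / K * (1 - cnj w * z) powr (of_real (- \<alpha>))" if "norm z < 1" for z
  proof -
    have "norm (cnj w * z) < 1"
      using w that norm_mult_less[of "cnj w" 1 z 1] by simp
    from sums_mult[OF inverse_moment_sums[OF \<alpha> this], of "G w / K"]
    have "(\<lambda>n. a n * z ^ n) sums (G w / K * (1 - cnj w * z) powr (- of_real \<alpha>))"
      by (simp add: an power_mult_distrib mult_ac)
    then show ?thesis using a[OF that] sums_unique2 by auto
  qed
  \<comment> \<open>the quotient of \<open>f\<close> by the expected extremal function\<close>
  define h where "h z = f z * (1 - cnj w * z) powr (of_real (2 * \<alpha> / p))" for z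
  have "norm (h z) = (norm (G w / K)) powr (2 / p)" if "z \<in> ball 0 1" for z
  proof -
    have nz1: "1 - cnj w * z \<noteq> 0" using Re_kernel_pos w that by auto
    have "norm (G z) = norm (G w / K) * norm (1 - cnj w * z) powr - \<alpha>"
      using Gz[of z] that by (simp only: norm_mult norm_powr_of_real[OF nz1] mem_ball_0)
    then have "norm (f z) powr p = (norm (G w / K))\<^sup>2 * norm (1 - cnj w * z) powr (- 2 * \<alpha>)"
      using fG[OF that] nz1 by (simp only: power_mult_distrib) (simp add: powr_power)
    then have "(norm (f z) powr p) powr (1 / p) = ((norm (G w / K))\<^sup>2 * norm (1 - cnj w * z) powr (- 2 * \<alpha>)) powr (1 / p)"
      by simp
    also have "(norm (f z) powr p) powr (1 / p) = norm (f z)"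
      using p by (simp add: powr_powr)
    also have "((norm (G w / K))\<^sup>2 * norm (1 - cnj w * z) powr (- 2 * \<alpha>)) powr (1 / p) =
        (norm (G w / K)) powr (2 / p) * norm (1 - cnj w * z) powr (- 2 * \<alpha> / p)"
      by (cases "G w / K = 0") (auto simp: powr_mult powr_powr simp flip: powr_numeral)
    finally show ?thesis
      using nz1 norm_powr_of_real[OF nz1, of "2 * \<alpha> / p"] by (simp add: h_def norm_mult powr_minus field_simps)
  qed
  moreover have "h holomorphic_on ball 0 1"
    unfolding h_def by (intro holomorphic_intros hol kernel_powr_holomorphic w)
  ultimately obtain C where C: "\<And>z. z \<in> ball 0 1 \<Longrightarrow> h z = C"
    using constant_modulus_imp_constant by blast
  show thesis
  proof
    fix z :: complex assume z: "z \<in> ball 0 1"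
    then have "1 - cnj w * z \<noteq> 0" using Re_kernel_pos w by auto
    then show "f z = C * (1 - cnj w * z) powr (of_real (- 2 * \<alpha> / p))"
      using C[OF z] by (auto simp: h_def powr_minus field_simps)
  qed
qed

text \<open>Every multiple of the kernel function, the zero function included, attains equality.\<close>

lemma wnorm_pow_kernel:
  assumes \<alpha>: "0 < \<alpha>" and p: "0 < p" and w: "norm w < 1"
    and f: "\<And>z. z \<in> ball 0 1 \<Longrightarrow> f z = C * (1 - cnj w * z) powr (of_real (- 2 * \<alpha> / p))"
  shows "ennreal (norm (f w) powr p * (1 - (norm w)\<^sup>2) powr \<alpha>) = wnorm_pow \<alpha> p f"
proof -
  define A where "A = norm C powr (p / 2)"
  define a where "a n = A * cnj w ^ n / moment \<alpha> n 1" for n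
  define G where "G z = A * (1 - cnj w * z) powr (- of_real \<alpha>)" for z
  have A2: "A\<^sup>2 = norm C powr p"
    by (cases "C = 0") (auto simp: A_def powr_power p)
  have fn: "norm (f z) powr p = A\<^sup>2 * norm (1 - cnj w * z) powr (- 2 * \<alpha>)" if "z \<in> ball 0 1" for z
  proof -
    have nz1: "1 - cnj w * z \<noteq> 0" using Re_kernel_pos w that by auto
    show ?thesis
      using f[OF that] norm_powr_of_real[OF nz1, of "- 2 * \<alpha> / p"] p
      by (simp add: norm_mult powr_mult powr_powr A2)
  qed
  have eq: "norm (f z) powr p = (norm (G z))\<^sup>2" if "z \<in> ball 0 1" for z
  proof -
    have nz1: "1 - cnj w * z \<noteq> 0" using Re_kernel_pos w that by auto
    show ?thesis
      using fn[OF that] norm_powr_of_real[OF nz1, of "- \<alpha>"] nz1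
      by (simp add: G_def norm_mult power_mult_distrib powr_power)
  qed
  have a: "(\<lambda>n. a n * z ^ n) sums G z" if "norm z < 1" for z
  proof -
    have "norm (cnj w * z) < 1"
      using w that norm_mult_less[of "cnj w" 1 z 1] by simp
    from sums_mult[OF inverse_moment_sums[OF \<alpha> this], of A] show ?thesis
      by (simp add: a_def G_def power_mult_distrib mult_ac)
  qed
  define x where "x = 1 - (norm w)\<^sup>2"
  have x: "0 < x" using w by (simp add: x_def power_less_one_iff)
  have "wnorm_pow \<alpha> p f = (\<Sum>n. ennreal ((norm (a n))\<^sup>2 * moment \<alpha> n 1))"
    unfolding wnorm_pow_eq_radial_energy
    by (rule radial_energy_square[OF a _ _ _ \<alpha> eq]) auto
  also have "\<dots> = (\<Sum>n. ennreal (A\<^sup>2 * ((norm w) ^ (2 * n) / moment \<alpha> n 1)))"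
  proof (rule suminf_cong)
    fix n
    have "(norm (a n))\<^sup>2 * moment \<alpha> n 1 = A\<^sup>2 * ((norm w) ^ (2 * n) / moment \<alpha> n 1)"
      using moment_1_pos[OF \<alpha>, of n]
      by (simp add: a_def norm_mult norm_divide norm_power power_mult_distrib power_divide power2_eq_square mult_2 power_add)
    then show "ennreal ((norm (a n))\<^sup>2 * moment \<alpha> n 1) = ennreal (A\<^sup>2 * ((norm w) ^ (2 * n) / moment \<alpha> n 1))"
      by simp
  qed
  also have "\<dots> = ennreal (A\<^sup>2 * x powr - \<alpha>)"
  proof -
    have s: "(\<lambda>n. A\<^sup>2 * ((norm w) ^ (2 * n) / moment \<alpha> n 1)) sums (A\<^sup>2 * x powr - \<alpha>)"
      unfolding x_def by (intro sums_mult kernel_norm_sums \<alpha> w)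
    have nn: "0 \<le> A\<^sup>2 * ((norm w) ^ (2 * n) / moment \<alpha> n 1)" for n
      using moment_1_pos[OF \<alpha>, of n] by simp
    show ?thesis
      by (subst suminf_ennreal2[OF nn sums_summable[OF s]]) (simp only: sums_unique[OF s, symmetric])
  qed
  also have "A\<^sup>2 * x powr - \<alpha> = norm (f w) powr p * x powr \<alpha>"
  proof -
    have "1 - cnj w * w = of_real x"
      by (simp add: x_def mult.commute[of "cnj w"] complex_norm_square[symmetric])
    then have "norm (1 - cnj w * w) = x" using x by simp
    then have "norm (f w) powr p = A\<^sup>2 * x powr (- 2 * \<alpha>)"
      using fn[of w] w by simp
    moreover have "x powr (- 2 * \<alpha>) * x powr \<alpha> = x powr - \<alpha>"
      by (simp flip: powr_add)
    ultimately show ?thesis by (simp add: mult.assoc)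
  qed
  finally show ?thesis by (simp add: x_def)
qed

section \<open>Removing the zeros in a disc\<close>

text \<open>A zero splits off globally on a domain, not only near the point.\<close>

lemma holomorphic_factor_zero:
  assumes hol: "f holomorphic_on S" and S: "open S" "connected S" "a \<in> S"
    and nonzero: "b \<in> S" "f b \<noteq> 0"
  obtains h n where "h holomorphic_on S" "h a \<noteq> 0" "\<And>z. z \<in> S \<Longrightarrow> f z = (z - a) ^ n * h z"
    "f a = 0 \<Longrightarrow> 0 < n"
proof (cases "f a = 0")
  case False
  then show thesis using that[of f 0] hol by simp
next
  case True
  have "\<not> f constant_on S"
    using True nonzero \<open>a \<in> S\<close> unfolding constant_on_def by metis
  then obtain g r n where g: "0 < n" "0 < r" "ball a r \<subseteq> S" "g holomorphic_on ball a r"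
      "\<And>w. w \<in> ball a r \<Longrightarrow> f w = (w - a) ^ n * g w" "\<And>w. w \<in> ball a r \<Longrightarrow> g w \<noteq> 0"
    using holomorphic_factor_zero_nonconstant[OF hol S True] by metis
  define h where "h z = (if z = a then g a else f z / (z - a) ^ n)" for z
  have h_ball: "h z = g z" if "z \<in> ball a r" for z
    using g(5)[OF that] by (simp add: h_def)
  show thesis
  proof
    have "h holomorphic_on ball a r \<union> (S - {a})"
    proof (rule holomorphic_on_Un)
      show "h holomorphic_on ball a r"
        using g(4) by (rule holomorphic_transform) (simp add: h_ball)
      have "(\<lambda>z. f z / (z - a) ^ n) holomorphic_on S - {a}"
        by (intro holomorphic_intros holomorphic_on_subset[OF hol]) auto
      then show "h holomorphic_on S - {a}"
        by (rule holomorphic_transform) (simp add: h_def)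
    qed (use S in auto)
    then show "h holomorphic_on S"
      by (rule holomorphic_on_subset) (use g(2) in auto)
    show "h a \<noteq> 0" using h_ball[of a] g(2,6) by simp
    show "f z = (z - a) ^ n * h z" if "z \<in> S" for z
      using True g(1) by (cases "z = a") (auto simp: h_def)
  qed (rule g(1))
qed

lemma blaschke_factor_norm_diff:
  fixes z a :: complex
  shows "(norm (of_real (R\<^sup>2) - cnj a * z))\<^sup>2 - R\<^sup>2 * (norm (z - a))\<^sup>2 =
    (R\<^sup>2 - (norm a)\<^sup>2) * (R\<^sup>2 - (norm z)\<^sup>2)"
  unfolding cmod_power2 by (simp add: power2_eq_square) (simp add: algebra_simps)

text \<open>The reciprocal of the Blaschke factor of the disc of radius \<open>R\<close> at \<open>a\<close> is
  \<open>(R\<^sup>2 - cnj a z) / (R (z - a))\<close>; its numerator over \<open>R\<close> is compared here with \<open>z - a\<close>.\<close>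

lemma blaschke_factor_norm:
  fixes z a :: complex
  assumes "0 < R"
  shows "norm z = R \<Longrightarrow> norm ((of_real (R\<^sup>2) - cnj a * z) / of_real R) = norm (z - a)"
    and "norm a < R \<Longrightarrow> norm z < R \<Longrightarrow> norm (z - a) \<le> norm ((of_real (R\<^sup>2) - cnj a * z) / of_real R)"
    and "norm a < R \<Longrightarrow> norm z \<le> R \<Longrightarrow> of_real (R\<^sup>2) - cnj a * z \<noteq> 0"
proof -
  note id = blaschke_factor_norm_diff[of R a z]
  have le: "norm (z - a) \<le> norm ((of_real (R\<^sup>2) - cnj a * z) / of_real R)"
    if "0 \<le> (R\<^sup>2 - (norm a)\<^sup>2) * (R\<^sup>2 - (norm z)\<^sup>2)"
  proof -
    have "(R * norm (z - a))\<^sup>2 \<le> (norm (of_real (R\<^sup>2) - cnj a * z))\<^sup>2"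
      using that id by (simp add: power_mult_distrib)
    then have "R * norm (z - a) \<le> norm (of_real (R\<^sup>2) - cnj a * z)"
      by (rule power2_le_imp_le) simp
    then show ?thesis using assms by (simp add: norm_divide field_simps)
  qed
  then show "norm (z - a) \<le> norm ((of_real (R\<^sup>2) - cnj a * z) / of_real R)" if "norm a < R" "norm z < R"
    using that by (auto intro!: mult_nonneg_nonneg simp: power_mono)
  show "norm ((of_real (R\<^sup>2) - cnj a * z) / of_real R) = norm (z - a)" if "norm z = R"
  proof -
    have "(norm (of_real (R\<^sup>2) - cnj a * z))\<^sup>2 = (R * norm (z - a))\<^sup>2"
      using id that by (simp add: power_mult_distrib)
    then have "norm (of_real (R\<^sup>2) - cnj a * z) = R * norm (z - a)"
      using assms by (subst (asm) power2_eq_iff_nonneg) auto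
    then show ?thesis using assms by (simp add: norm_divide)
  qed
  show "of_real (R\<^sup>2) - cnj a * z \<noteq> 0" if "norm a < R" "norm z \<le> R"
  proof
    assume "of_real (R\<^sup>2) - cnj a * z = 0"
    then have "norm (complex_of_real (R\<^sup>2)) = norm (cnj a * z)" by simp
    then have "R * R = norm a * norm z"
      by (simp add: norm_mult norm_power power2_eq_square)
    moreover have "norm a * norm z < R * R"
      using mult_left_mono[OF that(2), of "norm a"] mult_strict_right_mono[OF that(1) assms] by simp
    ultimately show False by simp
  qed
qed

lemma open_contains_annulus:
  fixes U :: "complex set"
  assumes U: "open U" and r: "0 < r" and sub: "\<And>z. norm z = r \<Longrightarrow> z \<in> U"
  obtains e where "0 < e" "\<And>z. \<bar>norm z - r\<bar> < e \<Longrightarrow> z \<in> U"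
proof -
  have "sphere 0 r \<subseteq> U" using sub by auto
  then obtain e where e: "0 < e" "(\<Union>x\<in>sphere 0 r. ball x e) \<subseteq> U"
    using compact_subset_open_imp_ball_epsilon_subset[OF compact_sphere U] by metis
  show thesis
  proof (rule that[of "min e r"])
    fix z :: complex assume z: "\<bar>norm z - r\<bar> < min e r"
    then have "z \<noteq> 0" by auto
    define x where "x = of_real (r / norm z) * z"
    have "norm x = r" using \<open>z \<noteq> 0\<close> r by (simp add: x_def norm_mult norm_divide)
    moreover have "dist x z < e"
    proof -
      have "x - z = of_real (r / norm z - 1) * z" by (simp add: x_def algebra_simps)
      then have "norm (x - z) = \<bar>r / norm z - 1\<bar> * \<bar>norm z\<bar>" by (simp only: norm_mult norm_of_real abs_norm_cancel)
      also have "\<dots> = \<bar>(r / norm z - 1) * norm z\<bar>" by (simp only: abs_mult)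
      also have "\<dots> = \<bar>norm z - r\<bar>" using \<open>z \<noteq> 0\<close> by (simp add: left_diff_distrib abs_minus_commute)
      finally show ?thesis using z by (simp add: dist_norm)
    qed
    ultimately have "z \<in> (\<Union>x\<in>sphere 0 r. ball x e)" by auto
    then show "z \<in> U" by (rule subsetD[OF e(2)])
  qed (use e r in auto)
qed

text \<open>The function \<open>g\<close> is the quotient of \<open>f\<close> by the finite Blaschke product of the zeros of \<open>f\<close> in the
  disc of radius \<open>R\<close>. It has no zeros on a slightly larger disc, on which therefore powers of \<open>g\<close> are
  available. The zeros are removed one point at a time, with full multiplicity.\<close>

lemma blaschke_factorization:
  assumes hol: "f holomorphic_on ball 0 \<rho>" and R: "0 < R" "R < \<rho>"
    and nz: "\<And>z. norm z = R \<Longrightarrow> f z \<noteq> 0"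
  obtains g \<rho>' where "R < \<rho>'" "\<rho>' \<le> \<rho>" "g holomorphic_on ball 0 \<rho>'" "\<And>z. z \<in> ball 0 \<rho>' \<Longrightarrow> g z \<noteq> 0"
    "\<And>z. norm z = R \<Longrightarrow> norm (f z) = norm (g z)"
    "\<And>z. norm z < R \<Longrightarrow> norm (f z) \<le> norm (g z)"
proof -
  have "\<exists>g. g holomorphic_on ball 0 \<rho> \<and> (\<forall>z \<in> cball 0 R. g z \<noteq> 0) \<and>
      (\<forall>z. norm z = R \<longrightarrow> norm (f z) = norm (g z)) \<and> (\<forall>z. norm z < R \<longrightarrow> norm (f z) \<le> norm (g z))"
    using hol nz
  proof (induction "card {z \<in> cball 0 R. f z = 0}" arbitrary: f rule: less_induct)
    case less
    have fnz: "f (of_real R) \<noteq> 0" using less.prems(2) R by simp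
    have nc: "\<not> f constant_on ball 0 \<rho>" if "f a = 0" "norm a \<le> R" for a
    proof
      assume "f constant_on ball 0 \<rho>"
      then have "f a = f (of_real R)" using that R by (auto simp: constant_on_def)
      then show False using that fnz by simp
    qed
    show ?case
    proof (cases "\<exists>a \<in> cball 0 R. f a = 0")
      case False
      then show ?thesis using less.prems by auto
    next
      case True
      then obtain a where a: "norm a \<le> R" "f a = 0" by auto
      then have aR: "norm a < R" using less.prems(2)[of a] by fastforce
      obtain h n where h: "h holomorphic_on ball 0 \<rho>" "h a \<noteq> 0"
          "\<And>z. z \<in> ball 0 \<rho> \<Longrightarrow> f z = (z - a) ^ n * h z" and "0 < n"
        by (rule holomorphic_factor_zero[OF less.prems(1), of a "of_real R"]) (use a R fnz in auto)
      define q where "q z = (of_real (R\<^sup>2) - cnj a * z) / of_real R" for z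
      define g where "g z = q z ^ n * h z" for z
      have qnz: "q z \<noteq> 0" if "norm z \<le> R" for z
        using blaschke_factor_norm(3)[OF R(1) aR that] R by (simp add: q_def)
      have hg: "g holomorphic_on ball 0 \<rho>"
        unfolding g_def q_def by (intro holomorphic_intros h) (use R in auto)
      have g_eq: "norm (f z) = norm (g z)" if "norm z = R" for z
        using blaschke_factor_norm(1)[OF R(1) that, of a] h(3)[of z] that R
        by (simp add: g_def q_def norm_mult norm_power)
      have g_le: "norm (f z) \<le> norm (g z)" if "norm z < R" for z
      proof -
        have "norm (z - a) \<le> norm (q z)"
          using blaschke_factor_norm(2)[OF R(1) aR that] by (simp add: q_def)
        then show ?thesis
          using h(3)[of z] that R by (auto simp: g_def norm_mult norm_power intro!: mult_right_mono power_mono)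
      qed
      have sub: "{z \<in> cball 0 R. g z = 0} \<subset> {z \<in> cball 0 R. f z = 0}"
      proof
        show "{z \<in> cball 0 R. g z = 0} \<subseteq> {z \<in> cball 0 R. f z = 0}"
          using h(3) qnz R by (auto simp: g_def)
        have "a \<in> {z \<in> cball 0 R. f z = 0}" "a \<notin> {z \<in> cball 0 R. g z = 0}"
          using a h(2) qnz[of a] by (auto simp: g_def)
        then show "{z \<in> cball 0 R. g z = 0} \<noteq> {z \<in> cball 0 R. f z = 0}" by blast
      qed
      have "finite {z \<in> cball 0 R. f z = 0}"
        by (rule holomorphic_compact_finite_zeros[OF less.prems(1)]) (use R nc[OF a(2,1)] in auto)
      then have "card {z \<in> cball 0 R. g z = 0} < card {z \<in> cball 0 R. f z = 0}"
        by (rule psubset_card_mono) (rule sub)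
      moreover have "g z \<noteq> 0" if "norm z = R" for z
        using g_eq[OF that] less.prems(2)[OF that] by auto
      ultimately obtain k where "k holomorphic_on ball 0 \<rho>" "\<forall>z \<in> cball 0 R. k z \<noteq> 0"
        "\<forall>z. norm z = R \<longrightarrow> norm (g z) = norm (k z)" "\<forall>z. norm z < R \<longrightarrow> norm (g z) \<le> norm (k z)"
        using less.hyps[of g] hg by blast
      then show ?thesis
        using g_eq g_le by (intro exI[of _ k]) (metis order_trans)
    qed
  qed
  then obtain g where g: "g holomorphic_on ball 0 \<rho>" "\<And>z. z \<in> cball 0 R \<Longrightarrow> g z \<noteq> 0"
    "\<And>z. norm z = R \<Longrightarrow> norm (f z) = norm (g z)" "\<And>z. norm z < R \<Longrightarrow> norm (f z) \<le> norm (g z)"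
    by blast
  have "open (ball 0 \<rho> \<inter> g -` (- {0}))"
    by (rule continuous_open_preimage) (use g(1) holomorphic_on_imp_continuous_on in auto)
  then obtain e where e: "0 < e" "\<And>z. \<bar>norm z - R\<bar> < e \<Longrightarrow> z \<in> ball 0 \<rho> \<inter> g -` (- {0})"
    using open_contains_annulus[OF _ R(1)] g(2) R by (metis (no_types, lifting) ComplI IntI mem_ball_0 mem_cball_0 order_refl singletonD vimageI)
  have sub: "z \<in> ball 0 \<rho> \<and> g z \<noteq> 0" if "norm z < R + e" for z
    using that g(2)[of z] R e(2)[of z] by (cases "norm z \<le> R") auto
  show thesis
  proof (rule that[of "min \<rho> (R + e)" g])
    show "g holomorphic_on ball 0 (min \<rho> (R + e))"
      by (rule holomorphic_on_subset[OF g(1)]) auto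
    show "g z \<noteq> 0" if "z \<in> ball 0 (min \<rho> (R + e))" for z
      using that sub by auto
  qed (use g R e in auto)
qed


text \<open>The factor belonging to one zero \<open>a\<close> is retained in the estimate inside the disc; it is what makes
  the inequalities below strict.\<close>

lemma blaschke_factorization_at_zero:
  assumes hol: "f holomorphic_on ball 0 \<rho>" and R: "0 < R" "R < \<rho>"
    and nz: "\<And>z. norm z = R \<Longrightarrow> f z \<noteq> 0" and a: "norm a < R" "f a = 0"
  obtains g \<rho>' where "R < \<rho>'" "\<rho>' \<le> \<rho>" "g holomorphic_on ball 0 \<rho>'" "\<And>z. z \<in> ball 0 \<rho>' \<Longrightarrow> g z \<noteq> 0"
    "\<And>z. norm z = R \<Longrightarrow> norm (f z) = norm (g z)"
    "\<And>z. norm z < R \<Longrightarrow> norm (f z) \<le> norm (of_real R * (z - a) / (of_real (R\<^sup>2) - cnj a * z)) * norm (g z)"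
proof -
  have "f (of_real R) \<noteq> 0" using nz R by simp
  then obtain h n where h: "h holomorphic_on ball 0 \<rho>" "\<And>z. z \<in> ball 0 \<rho> \<Longrightarrow> f z = (z - a) ^ n * h z" "0 < n"
    by (rule holomorphic_factor_zero[OF hol, of a "of_real R", rotated -2]) (use a R in auto)
  define q where "q z = (of_real (R\<^sup>2) - cnj a * z) / of_real R" for z
  define f1 where "f1 z = q z * ((z - a) ^ (n - 1) * h z)" for z
  have hf1: "f1 holomorphic_on ball 0 \<rho>"
    unfolding f1_def q_def by (intro holomorphic_intros h) (use R in auto)
  have f_eq: "f z = (z - a) * ((z - a) ^ (n - 1) * h z)" if "z \<in> ball 0 \<rho>" for z
    using h(2)[OF that] \<open>0 < n\<close> by (cases n) auto
  have f1_eq: "norm (f z) = norm (f1 z)" if "norm z = R" for z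
  proof -
    have "norm (q z) = norm (z - a)"
      using blaschke_factor_norm(1)[OF R(1) that, of a] by (simp add: q_def)
    then show ?thesis
      using f_eq[of z] that R by (simp add: f1_def norm_mult)
  qed
  have f1_in: "norm (f z) = norm (of_real R * (z - a) / (of_real (R\<^sup>2) - cnj a * z)) * norm (f1 z)" if "norm z < R" for z
  proof -
    have "of_real (R\<^sup>2) - cnj a * z \<noteq> 0"
      using blaschke_factor_norm(3)[OF R(1) a(1)] that by simp
    then have "f z = of_real R * (z - a) / (of_real (R\<^sup>2) - cnj a * z) * f1 z"
      using f_eq[of z] that R by (simp add: f1_def q_def)
    then show ?thesis by (metis norm_mult)
  qed
  obtain g \<rho>' where g: "R < \<rho>'" "\<rho>' \<le> \<rho>" "g holomorphic_on ball 0 \<rho>'" "\<And>z. z \<in> ball 0 \<rho>' \<Longrightarrow> g z \<noteq> 0"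
    "\<And>z. norm z = R \<Longrightarrow> norm (f1 z) = norm (g z)" "\<And>z. norm z < R \<Longrightarrow> norm (f1 z) \<le> norm (g z)"
    using blaschke_factorization[OF hf1 R] f1_eq nz by (metis norm_eq_zero)
  show thesis
    by (rule that[OF g(1-4)]) (use g(5,6) f1_eq f1_in in \<open>auto intro: mult_left_mono\<close>)
qed

section \<open>The circular means of a holomorphic function\<close>

lemma continuous_on_circle_family:
  assumes "continuous_on (ball 0 \<rho>) f" "A \<subseteq> {-\<rho><..<\<rho>}"
  shows "continuous_on (A \<times> B) (\<lambda>(r, t). f (of_real r * exp (\<i> * of_real t)))"
  unfolding case_prod_beta
  by (rule continuous_on_compose2[OF assms(1)])
     (use assms(2) in \<open>auto intro!: continuous_intros simp: norm_mult abs_if\<close>)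

lemma continuous_on_integral_mean_pow:
  assumes f: "continuous_on (ball 0 \<rho>) f" and p: "0 < p"
  shows "continuous_on {0..<\<rho>} (\<lambda>r. integral_mean_pow p r f)"
proof -
  have "continuous_on ({0..<\<rho>} \<times> cbox 0 (2*pi)) (\<lambda>(r, t). norm (f (of_real r * exp (\<i> * of_real t))) powr p / (2*pi))"
    unfolding case_prod_beta
    by (intro continuous_on_divide continuous_on_powr' continuous_on_norm continuous_on_const
        continuous_on_circle_family[OF f, unfolded case_prod_beta]) (use p in auto)
  from integral_continuous_on_param[OF this] show ?thesis
    by (simp add: integral_mean_pow_def[abs_def])
qed

lemma integral_mean_pow_0: "integral_mean_pow p 0 f = norm (f 0) powr p"
  by (simp add: integral_mean_pow_def)

lemma integral_mean_pow_nonneg: "0 \<le> integral_mean_pow p r f"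
  unfolding integral_mean_pow_def
proof (cases "(\<lambda>\<theta>. norm (f (of_real r * exp (\<i> * of_real \<theta>))) powr p / (2*pi)) integrable_on {0..2*pi}")
  case True
  then show "0 \<le> integral {0..2*pi} (\<lambda>\<theta>. norm (f (of_real r * exp (\<i> * of_real \<theta>))) powr p / (2*pi))"
    by (rule integral_nonneg) simp
next
  case False
  then show "0 \<le> integral {0..2*pi} (\<lambda>\<theta>. norm (f (of_real r * exp (\<i> * of_real \<theta>))) powr p / (2*pi))"
    by (metis not_integrable_integral order_refl)
qed

lemma integral_mean_pow_mono_functions:
  assumes f: "continuous_on (ball 0 \<rho>) f" and g: "continuous_on (ball 0 \<sigma>) g" and p: "0 < p"
    and r: "0 \<le> r" "r < \<rho>" "r < \<sigma>"
    and le: "\<And>z. norm z = r \<Longrightarrow> norm (f z) \<le> norm (g z)"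
  shows "integral_mean_pow p r f \<le> integral_mean_pow p r g"
proof -
  have int: "(\<lambda>\<theta>. norm (h (of_real r * exp (\<i> * of_real \<theta>))) powr p / (2*pi)) integrable_on {0..2*pi}"
    if "continuous_on (ball 0 \<tau>) h" "r < \<tau>" for h :: "complex \<Rightarrow> complex" and \<tau>
  proof (rule integrable_continuous_real)
    have "continuous_on {0..2*pi} (\<lambda>\<theta>. h (of_real r * exp (\<i> * of_real \<theta>)))"
      by (rule continuous_on_compose2[OF that(1)])
         (use r that(2) in \<open>auto intro!: continuous_intros simp: norm_mult\<close>)
    then show "continuous_on {0..2*pi} (\<lambda>\<theta>. norm (h (of_real r * exp (\<i> * of_real \<theta>))) powr p / (2*pi))"
      using p by (intro continuous_intros continuous_on_powr') auto
  qed
  show ?thesis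
    unfolding integral_mean_pow_def
    by (rule integral_le[OF int[OF f r(2)] int[OF g r(3)]])
       (use r p in \<open>auto intro!: divide_right_mono powr_mono2 le simp: norm_mult\<close>)
qed

lemma has_real_derivative_norm_powr:
  fixes F :: "real \<Rightarrow> complex"
  assumes "(F has_vector_derivative F') (at x within S)" "F x \<noteq> 0"
  shows "((\<lambda>s. norm (F s) powr p) has_real_derivative
     p * norm (F x) powr (p - 2) * (F x \<bullet> F')) (at x within S)"
proof -
  have D: "((\<lambda>s. F s \<bullet> F s) has_real_derivative 2 * (F x \<bullet> F')) (at x within S)"
  proof -
    have "((\<lambda>s. F s \<bullet> F s) has_derivative (\<lambda>h. F x \<bullet> (h *\<^sub>R F') + h *\<^sub>R F' \<bullet> F x)) (at x within S)"
      using assms(1) unfolding has_vector_derivative_def by (intro has_derivative_inner)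
    then show ?thesis
      unfolding has_field_derivative_def
      by (rule has_derivative_eq_rhs) (auto simp: fun_eq_iff inner_commute algebra_simps)
  qed
  have pos: "0 < F x \<bullet> F x" using assms(2) by simp
  have "((\<lambda>s. (F s \<bullet> F s) powr (p / 2)) has_real_derivative (p / 2) * (F x \<bullet> F x) powr (p / 2 - 1) * (2 * (F x \<bullet> F'))) (at x within S)"
    using DERIV_chain2[where f = "\<lambda>y. y powr (p / 2)" and g = "\<lambda>s. F s \<bullet> F s", OF has_real_derivative_powr[OF pos] D]
    by (simp add: mult_ac)
  moreover have "(F s \<bullet> F s) powr q = norm (F s) powr (2 * q)" for s q
    by (cases "F s = 0") (auto simp: dot_square_norm powr_powr simp flip: powr_numeral)
  ultimately show ?thesis by (simp add: algebra_simps)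
qed

text \<open>Differentiation under the integral sign needs \<open>|f|\<^sup>p\<close> to be smooth near the circle, hence the absence of
  zeros on it. Unless \<open>f\<close> vanishes identically, only finitely many radii up to a given \<open>R < \<rho>\<close> are excluded.\<close>

lemma integral_mean_pow_differentiable:
  assumes hol: "f holomorphic_on ball 0 \<rho>" and r: "0 < r" "r < \<rho>" and nz: "\<And>z. norm z = r \<Longrightarrow> f z \<noteq> 0"
  shows "(\<lambda>s. integral_mean_pow p s f) differentiable (at r)"
    and "\<exists>e>0. \<forall>z. \<bar>norm z - r\<bar> < e \<longrightarrow> norm z < \<rho> \<and> f z \<noteq> 0"
proof -
  have contf: "continuous_on (ball 0 \<rho>) f" by (rule holomorphic_on_imp_continuous_on[OF hol])
  have "open (ball 0 \<rho> \<inter> f -` (- {0}))"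
    by (rule continuous_open_preimage) (use contf in auto)
  then obtain e where e: "0 < e" "\<And>z. \<bar>norm z - r\<bar> < e \<Longrightarrow> z \<in> ball 0 \<rho> \<inter> f -` (- {0})"
    using open_contains_annulus[OF _ r(1)] nz r by (metis (no_types, lifting) ComplI IntI mem_ball_0 singletonD vimageI)
  then show "\<exists>e>0. \<forall>z. \<bar>norm z - r\<bar> < e \<longrightarrow> norm z < \<rho> \<and> f z \<noteq> 0"
    by (intro exI[of _ e]) auto
  define d where "d = min e r"
  have d: "0 < d" "d \<le> r" "d \<le> e" using e r by (auto simp: d_def)
  have nzd: "norm z < \<rho> \<and> f z \<noteq> 0" if "\<bar>norm z - r\<bar> < d" for z
    using e(2)[of z] that d by auto
  define U where "U = {r - d<..<r + d}"
  define Z where "Z s t = of_real s * exp (\<i> * of_real t)" for s t :: real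
  have Z: "norm (Z s t) < \<rho>" "f (Z s t) \<noteq> 0" if "s \<in> U" for s t
  proof -
    have "norm (Z s t) = s" using that d by (simp add: Z_def norm_mult U_def)
    then show "norm (Z s t) < \<rho>" "f (Z s t) \<noteq> 0" using nzd[of "Z s t"] that by (auto simp: U_def abs_if)
  qed
  define F' where "F' s t = p * norm (f (Z s t)) powr (p - 2) * (f (Z s t) \<bullet> (exp (\<i> * of_real t) * deriv f (Z s t))) / (2 * pi)" for s t
  have contZ: "continuous_on (U \<times> cbox 0 (2*pi)) (\<lambda>(s, t). h (Z s t))" if "continuous_on (ball 0 \<rho>) h" for h :: "complex \<Rightarrow> complex"
    unfolding case_prod_beta
    by (rule continuous_on_compose2[OF that]) (use Z in \<open>auto simp: Z_def intro!: continuous_intros\<close>)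
  have "((\<lambda>s. integral (cbox 0 (2*pi)) (\<lambda>t. norm (f (Z s t)) powr p / (2*pi))) has_field_derivative
      integral (cbox 0 (2*pi)) (F' r)) (at r within U)"
  proof (rule leibniz_rule_field_derivative)
    fix s t :: real assume s: "s \<in> U" "t \<in> cbox 0 (2*pi)"
    have "((\<lambda>z. f (z * exp (\<i> * of_real t))) has_field_derivative deriv f (Z s t) * exp (\<i> * of_real t)) (at (of_real s))"
      using holomorphic_derivI[OF hol open_ball, of "Z s t"] Z(1)[OF s(1), of t]
      by (intro DERIV_chain2[where f = f]) (auto intro!: derivative_eq_intros simp: Z_def)
    then have "((\<lambda>s. f (Z s t)) has_vector_derivative (exp (\<i> * of_real t) * deriv f (Z s t))) (at s)"
      using field_vector_diff_chain_at[OF has_vector_derivative_of_real[OF DERIV_ident[of "at s"]],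
          of "\<lambda>z. f (z * exp (\<i> * of_real t))"]
      by (simp add: o_def Z_def mult.commute)
    note D = has_real_derivative_norm_powr[OF this Z(2)[OF s(1)], of p]
    show "((\<lambda>s. norm (f (Z s t)) powr p / (2*pi)) has_field_derivative F' s t) (at s within U)"
      unfolding F'_def by (rule DERIV_cdivide[OF has_field_derivative_at_within[OF D]])
  next
    fix s assume s: "s \<in> U"
    have c: "continuous_on (cbox 0 (2*pi)) (\<lambda>t. f (Z s t))"
      by (rule continuous_on_compose2[OF contf]) (use Z(1)[OF s] in \<open>auto simp: Z_def intro!: continuous_intros\<close>)
    show "(\<lambda>t. norm (f (Z s t)) powr p / (2*pi)) integrable_on cbox 0 (2*pi)"
      by (intro integrable_continuous continuous_on_divide continuous_on_powr continuous_on_norm continuous_on_const c)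
         (use Z(2)[OF s] in auto)
  next
    have "continuous_on (ball 0 \<rho>) (deriv f)"
      by (intro holomorphic_on_imp_continuous_on holomorphic_deriv[OF hol]) simp
    note c = contZ[OF contf, unfolded case_prod_beta] contZ[OF this, unfolded case_prod_beta]
    show "continuous_on (U \<times> cbox 0 (2*pi)) (\<lambda>(s, t). F' s t)"
      unfolding F'_def case_prod_beta
      by (intro continuous_on_divide continuous_on_mult continuous_on_powr continuous_on_norm continuous_on_inner
          continuous_on_const continuous_on_exp continuous_on_of_real continuous_on_snd continuous_on_id c) (use Z in auto)
  qed (use d in \<open>auto simp: U_def\<close>)
  then have "((\<lambda>s. integral_mean_pow p s f) has_field_derivative integral (cbox 0 (2*pi)) (F' r)) (at r)"
    unfolding integral_mean_pow_def[abs_def] Z_def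
    using d by (subst (asm) at_within_open) (auto simp: U_def)
  then show "(\<lambda>s. integral_mean_pow p s f) differentiable (at r)"
    using real_differentiable_def by blast
qed

text \<open>For zero-free functions Parseval's formula exhibits the mean as a power series with nonnegative
  coefficients.\<close>

lemma integral_mean_pow_zero_free_mono:
  assumes hol: "g holomorphic_on ball 0 \<rho>" and nz: "\<And>z. z \<in> ball 0 \<rho> \<Longrightarrow> g z \<noteq> 0"
    and r: "0 \<le> r" "r \<le> s" "s < \<rho>"
  shows "integral_mean_pow p r g \<le> integral_mean_pow p s g"
proof -
  obtain G where G: "G holomorphic_on ball 0 \<rho>"
    and eq: "\<And>z. z \<in> ball 0 \<rho> \<Longrightarrow> norm (g z) powr p = (norm (G z))\<^sup>2"
    using zero_free_square[OF hol nz] r by auto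
  define a where "a n = (deriv ^^ n) G 0 / fact n" for n
  have a: "(\<lambda>n. a n * z ^ n) sums G z" if "norm z < \<rho>" for z
    using holomorphic_power_series[OF G, of z] that by (simp add: a_def)
  have "integral_mean_pow p t g = integral_mean_pow 2 t G" if "0 \<le> t" "t < \<rho>" for t
    using that by (intro integral_mean_pow_cong) (auto simp: eq)
  moreover have "integral_mean_pow 2 r G \<le> integral_mean_pow 2 s G"
    by (rule sums_le[OF _ parseval_circle[OF a] parseval_circle[OF a]])
       (use r in \<open>auto intro!: mult_left_mono power_mono\<close>)
  ultimately show ?thesis using r by simp
qed

text \<open>The zeros are removed on the disc of the larger radius; this does not change the mean over its
  boundary and does not decrease the mean over the smaller circle.\<close>

lemma integral_mean_pow_mono:
  assumes hol: "f holomorphic_on ball 0 \<rho>" and p: "0 < p"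
    and r: "0 \<le> r" "r \<le> R" "R < \<rho>" and nz: "\<And>z. norm z = R \<Longrightarrow> f z \<noteq> 0"
  shows "integral_mean_pow p r f \<le> integral_mean_pow p R f"
proof (cases "r = R")
  case False
  then have "0 < R" "r < R" using r by auto
  obtain g \<rho>' where g: "R < \<rho>'" "\<rho>' \<le> \<rho>" "g holomorphic_on ball 0 \<rho>'" "\<And>z. z \<in> ball 0 \<rho>' \<Longrightarrow> g z \<noteq> 0"
    "\<And>z. norm z = R \<Longrightarrow> norm (f z) = norm (g z)" "\<And>z. norm z < R \<Longrightarrow> norm (f z) \<le> norm (g z)"
    using blaschke_factorization[OF hol \<open>0 < R\<close> r(3) nz] by metis
  have "integral_mean_pow p r f \<le> integral_mean_pow p r g"
    by (rule integral_mean_pow_mono_functions[OF _ _ p, of \<rho> f \<rho>' g])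
       (use g r \<open>r < R\<close> hol in \<open>auto intro: holomorphic_on_imp_continuous_on\<close>)
  also have "\<dots> \<le> integral_mean_pow p R g"
    by (rule integral_mean_pow_zero_free_mono[OF g(3,4)]) (use r g in auto)
  also have "\<dots> = integral_mean_pow p R f"
    using \<open>0 < R\<close> by (intro integral_mean_pow_cong) (simp add: g(5))
  finally show ?thesis .
qed simp

lemma deriv_integral_mean_pow_nonneg:
  assumes hol: "f holomorphic_on ball 0 \<rho>" and p: "0 < p"
    and r: "0 < r" "r < \<rho>" and nz: "\<And>z. norm z = r \<Longrightarrow> f z \<noteq> 0"
  shows "0 \<le> deriv (\<lambda>s. integral_mean_pow p s f) r"
proof (rule ccontr)
  let ?M = "\<lambda>s. integral_mean_pow p s f"
  assume neg: "\<not> 0 \<le> deriv ?M r"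
  have "(?M has_real_derivative deriv ?M r) (at r)"
    using integral_mean_pow_differentiable(1)[OF hol r nz] by (simp add: DERIV_deriv_iff_real_differentiable)
  from DERIV_neg_dec_right[OF this] neg obtain d where d: "0 < d" "\<And>h. 0 < h \<Longrightarrow> h < d \<Longrightarrow> ?M (r + h) < ?M r"
    by auto
  obtain e where e: "0 < e" "\<And>z. \<bar>norm z - r\<bar> < e \<Longrightarrow> norm z < \<rho> \<and> f z \<noteq> 0"
    using integral_mean_pow_differentiable(2)[OF hol r nz] by blast
  define h where "h = min d e / 2"
  have h: "0 < h" "h < d" "h < e" using d e by (auto simp: h_def)
  have "norm (complex_of_real (r + h)) < \<rho>" using e(2)[of "of_real (r + h)"] h r by (simp del: of_real_add)
  then have "r + h < \<rho>" using h r by (simp del: of_real_add)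
  then have "?M r \<le> ?M (r + h)"
    using h r e(2) by (intro integral_mean_pow_mono[OF hol p]) auto
  then show False using d(2)[OF h(1,2)] by simp
qed

section \<open>Functions with a zero for \<open>\<alpha> \<le> 1\<close>\<close>

lemma finite_zero_radii:
  assumes hol: "f holomorphic_on ball 0 \<rho>" and R: "R < \<rho>" and nz: "b \<in> ball 0 \<rho>" "f b \<noteq> 0"
  shows "finite (norm ` {z \<in> cball 0 R. f z = 0})"
proof (cases "\<exists>z \<in> cball 0 R. f z = 0")
  case True
  then obtain z where z: "norm z \<le> R" "f z = 0" by auto
  have "\<not> f constant_on ball 0 \<rho>"
    using nz z R by (force simp: constant_on_def)
  then show ?thesis
    using R by (intro finite_imageI holomorphic_compact_finite_zeros[OF hol]) auto
next
  case False
  then have "{z \<in> cball 0 R. f z = 0} = {}" by auto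
  then show ?thesis by (simp only: image_empty finite.emptyI)
qed

text \<open>The finitely many radii of zeros of \<open>f\<close>, at which the mean need not be differentiable, are excluded
  by the form of the fundamental theorem of calculus that permits finitely many exceptional points.
  The mean itself is continuous across them.\<close>

lemma radial_energy_by_parts:
  assumes hol: "f holomorphic_on ball 0 \<rho>" and R: "0 < R" "R < \<rho>" "\<rho> \<le> 1" and p: "0 < p"
    and nz: "b \<in> ball 0 \<rho>" "f b \<noteq> 0"
  shows "radial_energy \<alpha> p R f = ennreal (integral_mean_pow p R f * (1 - R\<^sup>2) powr (\<alpha> - 1) -
      integral {0..R} (\<lambda>r. integral_mean_pow p r f * ((\<alpha> - 1) * (1 - r\<^sup>2) powr (\<alpha> - 2) * (- 2 * r))))"
    and "continuous_on {0..R} (\<lambda>r. integral_mean_pow p r f * ((\<alpha> - 1) * (1 - r\<^sup>2) powr (\<alpha> - 2) * (- 2 * r)))"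
proof -
  define M where "M r = integral_mean_pow p r f" for r
  define \<phi> where "\<phi> r = (1 - r\<^sup>2) powr (\<alpha> - 1)" for r :: real
  \<comment> \<open>the derivative of \<open>\<phi>\<close>\<close>
  define \<phi>' where "\<phi>' r = (\<alpha> - 1) * (1 - r\<^sup>2) powr (\<alpha> - 2) * (- 2 * r)" for r :: real
  define S where "S = norm ` {z \<in> cball 0 R. f z = 0}"
  have finS: "finite S"
    unfolding S_def by (rule finite_zero_radii[OF hol R(2) nz])
  have sq: "r\<^sup>2 < 1" if "r \<in> {0..R}" for r
    using that R by (simp add: power_less_one_iff)
  have contM: "continuous_on {0..R} M"
    unfolding M_def
    by (rule continuous_on_subset[OF continuous_on_integral_mean_pow[OF holomorphic_on_imp_continuous_on[OF hol] p]]) (use R in auto)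
  have cont\<phi>: "continuous_on {0..R} \<phi>"
    unfolding \<phi>_def using sq by (intro continuous_intros) force+
  have cont\<phi>': "continuous_on {0..R} \<phi>'"
    unfolding \<phi>'_def using sq by (intro continuous_intros) force+
  show "continuous_on {0..R} (\<lambda>r. integral_mean_pow p r f * ((\<alpha> - 1) * (1 - r\<^sup>2) powr (\<alpha> - 2) * (- 2 * r)))"
    using continuous_on_mult[OF contM cont\<phi>'] by (simp add: M_def \<phi>'_def)
  have nzS: "f z \<noteq> 0" if "r \<in> {0<..<R} - S" "norm z = r" for r z
    using that by (auto simp: S_def)
  have derM: "(M has_real_derivative deriv M r) (at r)" "0 \<le> deriv M r" if "r \<in> {0<..<R} - S" for r
    using integral_mean_pow_differentiable(1)[OF hol, of r p] deriv_integral_mean_pow_nonneg[OF hol p, of r] nzS[OF that] that R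
    by (auto simp: DERIV_deriv_iff_real_differentiable M_def[abs_def])
  have "((\<lambda>r. deriv M r * \<phi> r + \<phi>' r * M r) has_integral (M R * \<phi> R - M 0 * \<phi> 0)) {0..R}"
  proof (rule fundamental_theorem_of_calculus_interior_strong[OF finS])
    fix r assume r: "r \<in> {0<..<R} - S"
    have "(\<phi> has_real_derivative \<phi>' r) (at r)"
      using sq[of r] r unfolding \<phi>_def \<phi>'_def by (auto intro!: derivative_eq_intros simp: diff_diff_eq)
    from DERIV_mult[OF derM(1)[OF r] this]
    show "((\<lambda>r. M r * \<phi> r) has_vector_derivative deriv M r * \<phi> r + \<phi>' r * M r) (at r)"
      by (simp add: has_real_derivative_iff_has_vector_derivative)
  qed (use R contM cont\<phi> in \<open>auto intro: continuous_on_mult\<close>)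
  moreover have int: "((\<lambda>r. M r * \<phi>' r) has_integral integral {0..R} (\<lambda>r. M r * \<phi>' r)) {0..R}"
    by (intro integrable_integral integrable_continuous_real continuous_on_mult contM cont\<phi>')
  ultimately have "((\<lambda>r. (deriv M r * \<phi> r + \<phi>' r * M r) - M r * \<phi>' r) has_integral
      (M R * \<phi> R - M 0 * \<phi> 0 - integral {0..R} (\<lambda>r. M r * \<phi>' r))) {0..R}"
    by (rule has_integral_diff)
  then have D: "((\<lambda>r. deriv M r * \<phi> r) has_integral
      (M R * \<phi> R - M 0 - integral {0..R} (\<lambda>r. M r * \<phi>' r))) {0<..<R}"
    unfolding has_integral_Icc_iff_Ioo[symmetric] by (simp add: \<phi>_def mult.commute)
  \<comment> \<open>at the exceptional radii, where \<open>deriv\<close> may be any number, the integrand is set to \<open>0\<close>\<close>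
  have D': "((\<lambda>r. if r \<in> S then 0 else deriv M r * \<phi> r) has_integral
      (M R * \<phi> R - M 0 - integral {0..R} (\<lambda>r. M r * \<phi>' r))) {0<..<R}"
    by (rule has_integral_spike_finite[OF finS _ D]) auto
  have nonneg: "0 \<le> (if r \<in> S then 0 else deriv M r * \<phi> r)" if "r \<in> {0<..<R}" for r
    using derM(2)[of r] that by (simp add: \<phi>_def)
  have "(\<integral>\<^sup>+r\<in>{0<..<R}. ennreal (deriv M r * \<phi> r) \<partial>lborel) =
      (\<integral>\<^sup>+r\<in>{0<..<R}. ennreal (if r \<in> S then 0 else deriv M r * \<phi> r) \<partial>lborel)"
  proof (rule nn_integral_cong_AE)
    have "AE r in lborel. r \<notin> S"
      by (rule AE_not_in) (rule finite_imp_null_set_lborel[OF finS])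
    then show "AE r in lborel. ennreal (deriv M r * \<phi> r) * indicator {0<..<R} r =
        ennreal (if r \<in> S then 0 else deriv M r * \<phi> r) * indicator {0<..<R} r"
      by eventually_elim simp
  qed
  also have "\<dots> = ennreal (M R * \<phi> R - M 0 - integral {0..R} (\<lambda>r. M r * \<phi>' r))"
    by (rule nn_integral_has_integral_lebesgue'[OF nonneg D'])
  finally have I: "(\<integral>\<^sup>+r\<in>{0<..<R}. ennreal (deriv M r * \<phi> r) \<partial>lborel) =
      ennreal (M R * \<phi> R - M 0 - integral {0..R} (\<lambda>r. M r * \<phi>' r))" .
  have "0 \<le> M R * \<phi> R - M 0 - integral {0..R} (\<lambda>r. M r * \<phi>' r)"
    by (rule has_integral_nonneg[OF D' nonneg])
  moreover have "norm (f 0) powr p = M 0" "0 \<le> M 0"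
    by (auto simp: M_def integral_mean_pow_0)
  ultimately have "radial_energy \<alpha> p R f = ennreal (M R * \<phi> R - integral {0..R} (\<lambda>r. M r * \<phi>' r))"
    unfolding radial_energy_def using I
    by (simp add: M_def[abs_def] \<phi>_def flip: ennreal_plus)
  then show "radial_energy \<alpha> p R f = ennreal (integral_mean_pow p R f * (1 - R\<^sup>2) powr (\<alpha> - 1) -
      integral {0..R} (\<lambda>r. integral_mean_pow p r f * ((\<alpha> - 1) * (1 - r\<^sup>2) powr (\<alpha> - 2) * (- 2 * r))))"
    by (simp add: M_def \<phi>_def \<phi>'_def)
qed

text \<open>Since \<open>\<alpha> \<le> 1\<close>, the weight is nondecreasing, and after integration by parts the means over the interior
  circles enter with a negative sign.\<close>

lemma radial_energy_le_of_dominated: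
  assumes f: "f holomorphic_on ball 0 \<rho>" and g: "g holomorphic_on ball 0 \<rho>"
    and R: "0 < R" "R < \<rho>" "\<rho> \<le> 1" and p: "0 < p" and \<alpha>: "\<alpha> \<le> 1"
    and eq: "\<And>z. norm z = R \<Longrightarrow> norm (f z) = norm (g z)"
    and le: "\<And>z. norm z < R \<Longrightarrow> norm (f z) \<le> norm (g z)"
    and nz: "\<And>z. norm z = R \<Longrightarrow> f z \<noteq> 0"
  shows "radial_energy \<alpha> p R g \<le> radial_energy \<alpha> p R f"
proof -
  define \<phi>' where "\<phi>' r = (\<alpha> - 1) * (1 - r\<^sup>2) powr (\<alpha> - 2) * (- 2 * r)" for r :: real
  have b: "of_real R \<in> ball (0::complex) \<rho>" "f (of_real R) \<noteq> 0" "g (of_real R) \<noteq> 0"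
    using R nz[of "of_real R"] eq[of "of_real R"] by auto
  note pf = radial_energy_by_parts[OF f R p b(1,2), of \<alpha>, folded \<phi>'_def]
  note pg = radial_energy_by_parts[OF g R p b(1,3), of \<alpha>, folded \<phi>'_def]
  have M: "integral_mean_pow p r f \<le> integral_mean_pow p r g" if "r \<in> {0..R}" for r
    using that R eq le
    by (intro integral_mean_pow_mono_functions[OF holomorphic_on_imp_continuous_on[OF f] holomorphic_on_imp_continuous_on[OF g] p])
       (auto simp: le_less)
  have "integral_mean_pow p R f = integral_mean_pow p R g"
    using R by (intro integral_mean_pow_cong) (simp add: eq)
  moreover have "integral {0..R} (\<lambda>r. integral_mean_pow p r f * \<phi>' r) \<le> integral {0..R} (\<lambda>r. integral_mean_pow p r g * \<phi>' r)"
  proof (rule integral_le)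
    fix r assume r: "r \<in> {0..R}"
    have "0 \<le> (1 - \<alpha>) * (1 - r\<^sup>2) powr (\<alpha> - 2) * (2 * r)"
      using \<alpha> r by (intro mult_nonneg_nonneg) auto
    then have "0 \<le> \<phi>' r" by (simp add: \<phi>'_def algebra_simps)
    then show "integral_mean_pow p r f * \<phi>' r \<le> integral_mean_pow p r g * \<phi>' r"
      by (rule mult_right_mono[OF M[OF r]])
  qed (intro integrable_continuous_real pf(2) pg(2))+
  ultimately show ?thesis
    unfolding pf(1) pg(1) by (intro ennreal_leI) simp
qed

text \<open>Convergence of the truncated kernels as \<open>R \<rightarrow> 1\<close>, by dominated convergence of series.\<close>

lemma kernel_norm_tendsto:
  assumes \<alpha>: "0 < \<alpha>" "\<alpha> \<le> 1" and w: "norm (w :: complex) < 1"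
  shows "eventually (\<lambda>R. summable (\<lambda>n. (norm w) ^ (2 * n) / moment \<alpha> n R)) (at_left 1)"
    and "((\<lambda>R. \<Sum>n. (norm w) ^ (2 * n) / moment \<alpha> n R) \<longlongrightarrow> (1 - (norm w)\<^sup>2) powr - \<alpha>) (at_left 1)"
proof -
  \<comment> \<open>for radii above \<open>R0\<close> the series is dominated by the geometric series of ratio \<open>(|w| / R0)\<^sup>2\<close>\<close>
  obtain R0 where R0: "norm w < R0" "R0 < 1" using w dense by blast
  then have "0 < R0" by (meson norm_ge_zero le_less_trans)
  define q where "q = ((norm w) / R0)\<^sup>2"
  have q: "0 \<le> q" "q < 1" using R0 \<open>0 < R0\<close> by (auto simp: q_def power_less_one_iff)
  have ev: "eventually (\<lambda>R. R \<in> {R0<..<1}) (at_left 1)"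
    using R0 by (intro eventually_at_leftI[of R0]) auto
  have lim: "((\<lambda>R. (norm w) ^ (2 * n) / moment \<alpha> n R) \<longlongrightarrow> (norm w) ^ (2 * n) / moment \<alpha> n 1) (at_left 1)" for n
  proof (intro tendsto_intros)
    have "(moment \<alpha> n \<longlongrightarrow> moment \<alpha> n 1) (at 1 within {0..1})"
      using continuous_on_moment[OF \<alpha>(1), of n] by (auto simp: continuous_on_def)
    then show "(moment \<alpha> n \<longlongrightarrow> moment \<alpha> n 1) (at_left 1)"
      by (rule filterlim_mono) (auto simp: at_within_Icc_at_left)
    show "moment \<alpha> n 1 \<noteq> 0" using moment_1_pos[OF \<alpha>(1), of n] by simp
  qed
  have bound: "norm ((norm w) ^ (2 * n) / moment \<alpha> n R) \<le> q ^ n" if R: "R \<in> {R0<..<1}" for n R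
  proof -
    have 1: "R0 ^ (2 * n) \<le> moment \<alpha> n R"
    proof -
      have "R0 ^ (2 * n) \<le> R ^ (2 * n)" using R \<open>0 < R0\<close> by (intro power_mono) auto
      also have "\<dots> \<le> moment \<alpha> n R" by (rule moment_ge_power) (use \<alpha> R \<open>0 < R0\<close> in auto)
      finally show ?thesis .
    qed
    moreover have "0 < R0 ^ (2 * n)" using \<open>0 < R0\<close> by simp
    ultimately have "0 < moment \<alpha> n R" by linarith
    then have "norm ((norm w) ^ (2 * n) / moment \<alpha> n R) = (norm w) ^ (2 * n) / moment \<alpha> n R"
      by simp
    also have "\<dots> \<le> (norm w) ^ (2 * n) / R0 ^ (2 * n)"
      using 1 \<open>0 < R0 ^ (2 * n)\<close> by (intro divide_left_mono) auto
    also have "\<dots> = q ^ n" by (simp add: q_def power_mult[symmetric] power_divide)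
    finally show ?thesis .
  qed
  have "eventually (\<lambda>(n, R). norm ((norm w) ^ (2 * n) / moment \<alpha> n R) \<le> q ^ n) (at_top \<times>\<^sub>F at_left 1)"
    unfolding eventually_prod_filter
    by (intro exI[of _ "\<lambda>_. True"] exI[of _ "\<lambda>R. R \<in> {R0<..<1}"]) (use ev bound in auto)
  from tannerys_theorem[OF lim this] q
  have T: "eventually (\<lambda>R. summable (\<lambda>n. norm ((norm w) ^ (2 * n) / moment \<alpha> n R))) (at_left 1)"
    "((\<lambda>R. \<Sum>n. (norm w) ^ (2 * n) / moment \<alpha> n R) \<longlongrightarrow> (\<Sum>n. (norm w) ^ (2 * n) / moment \<alpha> n 1)) (at_left 1)"
    by (auto simp: summable_geometric_iff)
  show "eventually (\<lambda>R. summable (\<lambda>n. (norm w) ^ (2 * n) / moment \<alpha> n R)) (at_left 1)"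
    using T(1) by eventually_elim (rule summable_norm_cancel)
  show "((\<lambda>R. \<Sum>n. (norm w) ^ (2 * n) / moment \<alpha> n R) \<longlongrightarrow> (1 - (norm w)\<^sup>2) powr - \<alpha>) (at_left 1)"
    using T(2) sums_unique[OF kernel_norm_sums[OF \<alpha>(1) w]] by simp
qed

lemma exists_zero_free_radius:
  assumes hol: "f holomorphic_on ball 0 1" and nz: "b \<in> ball 0 1" "f b \<noteq> 0" and c: "0 \<le> c" "c < 1"
  obtains R where "c < R" "R < 1" "\<And>z. norm z = R \<Longrightarrow> f z \<noteq> 0"
proof -
  obtain d where d: "c < d" "d < 1" using c dense by blast
  have "infinite ({c<..<d} - norm ` {z \<in> cball 0 d. f z = 0})"
    using finite_zero_radii[OF hol d(2) nz] d by (intro Diff_infinite_finite) auto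
  then obtain R where "R \<in> {c<..<d} - norm ` {z \<in> cball 0 d. f z = 0}"
    using infinite_imp_nonempty by blast
  then show thesis using that[of R] d by force
qed

text \<open>The pointwise estimate for \<open>f\<close> divided by the modulus of the Blaschke factor of a zero.
  The restriction to zero-free radii is harmless in the limit: if the estimate failed, then the truncated
  estimate would fail for all \<open>R\<close> close to \<open>1\<close>, and these include a zero-free radius.\<close>

lemma wnorm_pow_ge_of_zero:
  assumes \<alpha>: "0 < \<alpha>" "\<alpha> \<le> 1" and p: "0 < p" and hol: "f holomorphic_on ball 0 1"
    and w: "norm w < 1" "f w \<noteq> 0" and a: "norm a < 1" "f a = 0"
  shows "ennreal ((norm (f w) / norm (Moebius_function 0 a w)) powr p * (1 - (norm w)\<^sup>2) powr \<alpha>) \<le> wnorm_pow \<alpha> p f"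
proof (rule ccontr)
  define b where "b R = norm (of_real R * (w - a) / (of_real (R\<^sup>2) - cnj a * w))" for R :: real
  define K where "K R = (\<Sum>n. (norm w) ^ (2 * n) / moment \<alpha> n R)" for R
  have "w \<noteq> a" using w a by auto
  have nz1: "1 - cnj a * w \<noteq> 0" using Re_kernel_pos a w by auto
  have x: "0 < 1 - (norm w)\<^sup>2" using w by (simp add: power_less_one_iff)
  have b1: "(b \<longlongrightarrow> norm (Moebius_function 0 a w)) (at_left 1)"
    unfolding b_def using nz1 by (auto intro!: tendsto_eq_intros simp: Moebius_function_simple)
  have b1nz: "norm (Moebius_function 0 a w) \<noteq> 0"
    using \<open>w \<noteq> a\<close> nz1 by (simp add: Moebius_function_simple)
  have "((\<lambda>R. (norm (f w) / b R) powr p / K R) \<longlongrightarrow>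
      (norm (f w) / norm (Moebius_function 0 a w)) powr p / (1 - (norm w)\<^sup>2) powr - \<alpha>) (at_left 1)"
    unfolding K_def using x w b1nz
    by (intro tendsto_intros b1 kernel_norm_tendsto \<alpha> w) auto
  then have "((\<lambda>R. ennreal ((norm (f w) / b R) powr p / K R)) \<longlongrightarrow>
      ennreal ((norm (f w) / norm (Moebius_function 0 a w)) powr p * (1 - (norm w)\<^sup>2) powr \<alpha>)) (at_left 1)"
    by (intro tendsto_ennrealI) (simp add: powr_minus_divide)
  moreover assume "\<not> ennreal ((norm (f w) / norm (Moebius_function 0 a w)) powr p * (1 - (norm w)\<^sup>2) powr \<alpha>) \<le> wnorm_pow \<alpha> p f"
  ultimately have "eventually (\<lambda>R. wnorm_pow \<alpha> p f < ennreal ((norm (f w) / b R) powr p / K R)) (at_left 1)"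
    by (intro order_tendstoD) (auto simp: not_le)
  then have "eventually (\<lambda>R. wnorm_pow \<alpha> p f < ennreal ((norm (f w) / b R) powr p / K R) \<and>
      summable (\<lambda>n. (norm w) ^ (2 * n) / moment \<alpha> n R)) (at_left 1)"
    using kernel_norm_tendsto(1)[OF \<alpha> w(1)] by (rule eventually_conj)
  then obtain c where c: "c < 1" "\<And>R. c < R \<Longrightarrow> R < 1 \<Longrightarrow> wnorm_pow \<alpha> p f < ennreal ((norm (f w) / b R) powr p / K R) \<and>
      summable (\<lambda>n. (norm w) ^ (2 * n) / moment \<alpha> n R)"
    using eventually_at_left[of 0 "1::real"] by auto
  obtain R where R: "max c (max (norm w) (norm a)) < R" "R < 1" and nzR: "\<And>z. norm z = R \<Longrightarrow> f z \<noteq> 0"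
    by (rule exists_zero_free_radius[OF hol, of w "max c (max (norm w) (norm a))"]) (use w a c in \<open>auto simp: le_max_iff_disj\<close>)
  then have R': "0 < R" "c < R" "norm w < R" "norm a < R" by (auto intro: le_less_trans[OF norm_ge_zero])
  obtain g \<rho> where g: "R < \<rho>" "\<rho> \<le> 1" "g holomorphic_on ball 0 \<rho>" "\<And>z. z \<in> ball 0 \<rho> \<Longrightarrow> g z \<noteq> 0"
    "\<And>z. norm z = R \<Longrightarrow> norm (f z) = norm (g z)"
    "\<And>z. norm z < R \<Longrightarrow> norm (f z) \<le> norm (of_real R * (z - a) / (of_real (R\<^sup>2) - cnj a * z)) * norm (g z)"
    using blaschke_factorization_at_zero[OF hol R'(1) R(2) nzR R'(4) a(2)] by metis
  have fg: "norm (f z) \<le> norm (g z)" if "norm z < R" for z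
  proof -
    have "norm (of_real R * (z - a) / (of_real (R\<^sup>2) - cnj a * z)) \<le> 1"
    proof -
      let ?D = "of_real (R\<^sup>2) - cnj a * z"
      have "norm (z - a) \<le> norm ?D / \<bar>R\<bar>"
        using blaschke_factor_norm(2)[OF R'(1) R'(4) that] by (simp only: norm_divide norm_of_real)
      then have "\<bar>R\<bar> * norm (z - a) \<le> norm ?D"
        using R'(1) by (simp only: abs_of_pos field_simps)
      moreover have "0 < norm ?D"
        using blaschke_factor_norm(3)[OF R'(1) R'(4), of z] that by simp
      ultimately show ?thesis
        by (simp only: norm_divide norm_mult norm_of_real divide_le_eq_1_pos)
    qed
    from mult_right_mono[OF this norm_ge_zero[of "g z"]] g(6)[OF that] show ?thesis by simp
  qed
  have pos: "0 < moment \<alpha> n R" for n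
    using moment_ge_power[OF \<alpha> _ R(2), of n] R'(1) by (smt (verit) zero_less_power)
  have "b R \<noteq> 0"
    using \<open>w \<noteq> a\<close> R'(1) blaschke_factor_norm(3)[OF R'(1,4), of w] R'(3) by (simp add: b_def)
  then have bpos: "0 < b R" by (simp add: b_def)
  have Ks: "(\<lambda>n. (norm w) ^ (2 * n) / moment \<alpha> n R) sums K R"
    unfolding K_def using c(2)[OF R'(2) R(2)] by (intro summable_sums) simp
  have "0 \<le> K R"
    by (rule sums_le[OF _ sums_zero Ks]) (use pos in \<open>auto simp: less_imp_le\<close>)
  have "norm (f w) / b R \<le> norm (g w)"
    using g(6)[OF R'(3)] bpos by (simp add: b_def field_simps)
  then have "ennreal ((norm (f w) / b R) powr p / K R) \<le> ennreal (norm (g w) powr p / K R)"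
    using bpos p \<open>0 \<le> K R\<close> by (intro ennreal_leI divide_right_mono powr_mono2) auto
  also have "\<dots> \<le> radial_energy \<alpha> p R g"
    by (rule radial_energy_zero_free_ge[OF g(3,4) R'(1) _ _ \<alpha>(1) _ pos Ks]) (use g R' R in auto)
  also have "\<dots> \<le> radial_energy \<alpha> p R f"
    by (rule radial_energy_le_of_dominated[OF holomorphic_on_subset[OF hol] g(3) R'(1) g(1,2) p \<alpha>(2) g(5) fg nzR])
       (use g in auto)
  also have "\<dots> \<le> wnorm_pow \<alpha> p f"
    unfolding wnorm_pow_eq_radial_energy by (rule radial_energy_mono) (use R in simp)
  finally show False using c(2)[OF R'(2) R(2)] by (meson leD)
qed

lemma wnorm_pow_strict_of_zero_le_1:
  assumes \<alpha>: "0 < \<alpha>" "\<alpha> \<le> 1" and p: "0 < p" and hol: "f holomorphic_on ball 0 1"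
    and w: "norm w < 1" "f w \<noteq> 0" and a: "norm a < 1" "f a = 0"
  shows "ennreal (norm (f w) powr p * (1 - (norm w)\<^sup>2) powr \<alpha>) < wnorm_pow \<alpha> p f"
proof -
  have "w \<noteq> a" using w a by auto
  then have "0 < norm (Moebius_function 0 a w)"
    using Re_kernel_pos(2)[OF a(1) w(1)] by (simp add: Moebius_function_simple)
  moreover have "norm (Moebius_function 0 a w) < 1"
    by (rule Moebius_function_norm_lt_1[OF a(1) w(1)])
  ultimately have "norm (f w) < norm (f w) / norm (Moebius_function 0 a w)"
    using w by (simp add: field_simps)
  then have "norm (f w) powr p < (norm (f w) / norm (Moebius_function 0 a w)) powr p"
    by (intro powr_less_mono2 p) auto
  moreover have "0 < (1 - (norm w)\<^sup>2) powr \<alpha>"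
  proof -
    have "(norm w)\<^sup>2 < 1" using w by (simp add: power_less_one_iff)
    then show ?thesis by simp
  qed
  ultimately have lt: "norm (f w) powr p * (1 - (norm w)\<^sup>2) powr \<alpha> <
      (norm (f w) / norm (Moebius_function 0 a w)) powr p * (1 - (norm w)\<^sup>2) powr \<alpha>"
    by (rule mult_strict_right_mono)
  then have "ennreal (norm (f w) powr p * (1 - (norm w)\<^sup>2) powr \<alpha>) <
      ennreal ((norm (f w) / norm (Moebius_function 0 a w)) powr p * (1 - (norm w)\<^sup>2) powr \<alpha>)"
    by (intro ennreal_lessI le_less_trans[OF _ lt]) auto
  also have "\<dots> \<le> wnorm_pow \<alpha> p f"
    by (rule wnorm_pow_ge_of_zero[OF assms])
  finally show ?thesis .
qed

section \<open>Area integrals in polar coordinates and disc automorphisms\<close>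

text \<open>The infix dollar sign denotes vector components in what follows, not coefficients of power series.\<close>

no_notation fps_nth (infixl \<open>$\<close> 75)

text \<open>The plane appears in three guises: as pairs, for iterated integrals; as vectors, for the
  transformation formula with Jacobian determinants; and as complex numbers, for holomorphic maps. The
  following three maps identify them.\<close>

definition vec2 :: "real \<times> real \<Rightarrow> real ^ 2"
  where "vec2 x = vector [fst x, snd x]"

definition of_vec2 :: "real ^ 2 \<Rightarrow> complex"
  where "of_vec2 x = Complex (x $ 1) (x $ 2)"

definition to_vec2 :: "complex \<Rightarrow> real ^ 2"
  where "to_vec2 z = vector [Re z, Im z]"

lemma vec2_nth [simp]: "vec2 x $ 1 = fst x" "vec2 x $ 2 = snd x"
  by (simp_all add: vec2_def)

lemma to_vec2_nth [simp]: "to_vec2 z $ 1 = Re z" "to_vec2 z $ 2 = Im z"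
  by (simp_all add: to_vec2_def)

lemma of_to_vec2 [simp]: "of_vec2 (to_vec2 z) = z"
  by (simp add: of_vec2_def complex_eq_iff)

lemma borel_measurable_vec2 [measurable]: "vec2 \<in> borel_measurable borel"
proof (rule borel_measurable_continuous_onI)
  have "bounded_linear vec2"
    by (rule linear_conv_bounded_linear[THEN iffD1], rule linearI)
       (simp_all add: vec_eq_iff forall_2)
  then show "continuous_on UNIV vec2"
    by (rule linear_continuous_on)
qed

lemma lborel_vec2: "distr lborel borel vec2 = lborel"
proof (rule lborel_eqI[symmetric])
  fix l u :: "real ^ 2" assume lu: "\<And>b. b \<in> Basis \<Longrightarrow> l \<bullet> b \<le> u \<bullet> b"
  have le: "l $ i \<le> u $ i" for i
    using lu[of "axis i 1"] by (simp add: inner_axis)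
  have Bas: "(Basis :: (real^2) set) = {axis 1 1, axis 2 1}"
    by (auto simp: Basis_vec_def exhaust_2) (metis exhaust_2)
  have ne: "axis 1 1 \<noteq> (axis 2 1 :: real^2)"
    by (simp add: axis_eq_axis)
  have "vec2 -` box l u = box (l $ 1) (u $ 1) \<times> box (l $ 2) (u $ 2)"
    by (auto simp: mem_box_cart forall_2)
  then have "emeasure (distr lborel borel vec2) (box l u) =
      emeasure (lborel \<Otimes>\<^sub>M lborel) (box (l $ 1) (u $ 1) \<times> box (l $ 2) (u $ 2))"
    by (subst emeasure_distr) (auto simp: lborel_prod)
  also have "\<dots> = ennreal ((u$1 - l$1) * (u$2 - l$2))"
    by (subst lborel.emeasure_pair_measure_Times)
       (auto simp: le emeasure_lborel_box_eq ennreal_mult'' simp flip: box_real(1))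
  also have "\<dots> = ennreal (\<Prod>b\<in>Basis. (u - l) \<bullet> b)"
    unfolding Bas using ne by (simp add: inner_axis)
  finally show "emeasure (distr lborel borel vec2) (box l u) = (\<Prod>b\<in>Basis. (u - l) \<bullet> b)" .
qed simp

lemma nn_integral_vec2:
  assumes [measurable]: "k \<in> borel_measurable borel"
  shows "(\<integral>\<^sup>+x. k x \<partial>lborel) = (\<integral>\<^sup>+r. \<integral>\<^sup>+t. k (vec2 (r, t)) \<partial>lborel \<partial>lborel)"
proof -
  have "(\<integral>\<^sup>+x. k x \<partial>lborel) = (\<integral>\<^sup>+x. k x \<partial>distr lborel borel vec2)"
    by (simp add: lborel_vec2)
  also have "\<dots> = (\<integral>\<^sup>+x. k (vec2 x) \<partial>(lborel \<Otimes>\<^sub>M lborel))"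
    by (subst nn_integral_distr) (simp_all add: lborel_prod)
  also have "\<dots> = (\<integral>\<^sup>+r. \<integral>\<^sup>+t. k (vec2 (r, t)) \<partial>lborel \<partial>lborel)"
    by (subst lborel.nn_integral_fst[symmetric]) (simp_all add: lborel_prod)
  finally show ?thesis .
qed

text \<open>The open rectangle of polar coordinates of the unit disc. Polar coordinates map it injectively onto
  the disc slit along a radius.\<close>

definition polar_rect :: "(real ^ 2) set"
  where "polar_rect = {x. 0 < x$1 \<and> x$1 < 1 \<and> 0 < x$2 \<and> x$2 < 2*pi}"

definition polar :: "real ^ 2 \<Rightarrow> complex" where "polar x = of_real (x$1) * cis (x$2)"

lemma has_derivative_to_vec2:
  assumes "(f has_derivative f') F" shows "((\<lambda>x. to_vec2 (f x)) has_derivative (\<lambda>x. to_vec2 (f' x))) F"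
proof -
  have "bounded_linear to_vec2"
    by (rule linear_conv_bounded_linear[THEN iffD1], rule linearI)
       (simp_all add: vec_eq_iff forall_2)
  from bounded_linear.has_derivative[OF this assms] show ?thesis .
qed

lemma has_derivative_polar:
  "(polar has_derivative (\<lambda>h. cis (x$2) * (of_real (h$1) + \<i> * of_real (x$1 * h$2)))) (at x within S)"
proof -
  have 1: "((\<lambda>x::real^2. x$i) has_derivative (\<lambda>h. h$i)) (at x within S)" for i
    by (rule bounded_linear_imp_has_derivative) (rule bounded_linear_vec_nth)
  have of_real: "((\<lambda>x::real^2. complex_of_real (x$i)) has_derivative (\<lambda>h. of_real (h$i))) (at x within S)" for i
    by (rule bounded_linear.has_derivative[OF bounded_linear_of_real 1])
  have "((\<lambda>x::real^2. \<i> * complex_of_real (x$2)) has_derivative (\<lambda>h. \<i> * of_real (h$2))) (at x within S)"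
    by (rule bounded_linear.has_derivative[OF bounded_linear_mult_right of_real])
  from has_derivative_compose[OF this, of exp "\<lambda>h. exp (\<i> * complex_of_real (x$2)) * h"]
  have 2: "((\<lambda>x::real^2. cis (x$2)) has_derivative (\<lambda>h. cis (x$2) * (\<i> * of_real (h$2)))) (at x within S)"
    using DERIV_exp[of "\<i> * complex_of_real (x$2)"]
    by (simp add: has_field_derivative_def cis_conv_exp)
  have "(polar has_derivative (\<lambda>h. of_real (x$1) * (cis (x$2) * (\<i> * of_real (h$2))) + of_real (h$1) * cis (x$2))) (at x within S)"
    unfolding polar_def by (rule has_derivative_mult[OF of_real 2])
  then show ?thesis
    by (simp add: algebra_simps)
qed

lemma polar_eq_iff:
  assumes "x \<in> polar_rect" "y \<in> polar_rect" "polar x = polar y"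
  shows "x = y"
proof -
  have 1: "x$1 = y$1"
    using assms(1,2) arg_cong[OF assms(3), of norm] by (simp add: polar_def norm_mult polar_rect_def)
  then have "cis (x$2) = cis (y$2)"
    using assms by (auto simp: polar_def polar_rect_def)
  then obtain n :: int where "\<i> * of_real (x$2) = \<i> * of_real (y$2) + of_int (2 * n) * pi * \<i>"
    unfolding cis_conv_exp exp_eq by blast
  then have n: "x$2 = y$2 + 2 * n * pi"
    by (simp add: complex_eq_iff)
  moreover have "\<bar>x$2 - y$2\<bar> < 2 * pi"
    using assms(1,2) by (auto simp: polar_rect_def)
  ultimately have "\<bar>real_of_int n\<bar> < 1"
    by (auto simp: abs_mult)
  then have "n = 0" by linarith
  with n 1 show ?thesis
    by (simp add: vec_eq_iff forall_2)
qed

lemma polar_image: "polar ` polar_rect \<subseteq> ball 0 1"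
    "ball 0 1 - {z. Im z = 0} \<subseteq> polar ` polar_rect"
proof -
  show "polar ` polar_rect \<subseteq> ball 0 1"
    by (auto simp: polar_rect_def polar_def norm_mult)
  show "ball 0 1 - {z. Im z = 0} \<subseteq> polar ` polar_rect"
  proof
    fix z assume z: "z \<in> ball 0 1 - {z. Im z = 0}"
    then have "z \<noteq> 0" by auto
    have "0 \<le> Arg2pi z" "Arg2pi z < 2 * pi" "z = norm z * exp (\<i> * Arg2pi z)"
      using Arg2pi by (auto simp: is_Arg_def)
    moreover have "Arg2pi z \<noteq> 0"
      using z by (auto simp: Arg2pi_eq_0 complex_is_Real_iff)
    ultimately have "vector [norm z, Arg2pi z] \<in> polar_rect" "polar (vector [norm z, Arg2pi z]) = z"
      using z \<open>z \<noteq> 0\<close> by (auto simp: polar_rect_def polar_def cis_conv_exp)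
    then show "z \<in> polar ` polar_rect" by (metis imageI)
  qed
qed

text \<open>The Jacobian determinant of a holomorphic map with derivative \<open>c\<close>, composed with polar coordinates
  at radius \<open>r\<close>; the unimodular factor \<open>u\<close> stands for the direction of the ray.\<close>

lemma det_holomorphic_polar:
  "det (matrix (\<lambda>h::real^2. to_vec2 (c * (u * (of_real (h$1) + \<i> * of_real (r * h$2)))))) =
     (norm c)\<^sup>2 * (norm u)\<^sup>2 * r"
  unfolding det_2 matrix_def
  by (simp add: axis_def cmod_power2) (simp add: algebra_simps power2_eq_square)

lemma negligible_real_axis: "negligible (to_vec2 ` {z. Im z = 0})"
proof (rule negligible_subset)
  show "negligible {x::real^2. axis 2 1 \<bullet> x = 0}"
    by (rule negligible_hyperplane) (simp add: axis_eq_0_iff)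
  show "to_vec2 ` {z. Im z = 0} \<subseteq> {x::real^2. axis 2 1 \<bullet> x = 0}"
    by (auto simp: inner_axis inner_commute)
qed

lemma negligible_holomorphic_image:
  assumes "\<Phi> holomorphic_on ball 0 1"
  shows "negligible (to_vec2 ` \<Phi> ` (ball 0 1 \<inter> {z. Im z = 0}))"
proof -
  let ?N = "to_vec2 ` (ball 0 1 \<inter> {z. Im z = 0})"
  have neg: "negligible ?N"
    by (rule negligible_subset[OF negligible_real_axis]) auto
  have bl: "bounded_linear of_vec2"
    by (rule linear_conv_bounded_linear[THEN iffD1], rule linearI)
       (simp_all add: of_vec2_def complex_eq_iff)
  have "(to_vec2 \<circ> \<Phi> \<circ> of_vec2) differentiable_on ?N"
    unfolding differentiable_on_def
  proof
    fix x assume "x \<in> ?N"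
    then have "of_vec2 x \<in> ball 0 1" by auto
    then have "(\<Phi> has_field_derivative deriv \<Phi> (of_vec2 x)) (at (of_vec2 x))"
      using assms by (simp add: holomorphic_derivI)
    then have D: "(\<Phi> has_derivative (\<lambda>h. deriv \<Phi> (of_vec2 x) * h)) (at (of_vec2 x))"
      by (simp add: has_field_derivative_def)
    have "(of_vec2 has_derivative of_vec2) (at x within ?N)"
      by (rule bounded_linear_imp_has_derivative) (rule bl)
    from has_derivative_to_vec2[OF has_derivative_compose[OF this D]]
    show "(to_vec2 \<circ> \<Phi> \<circ> of_vec2) differentiable at x within ?N"
      unfolding differentiable_def o_def by blast
  qed
  from negligible_differentiable_image_negligible[OF _ neg this]
  have "negligible ((to_vec2 \<circ> \<Phi> \<circ> of_vec2) ` ?N)" by simp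
  also have "(to_vec2 \<circ> \<Phi> \<circ> of_vec2) ` ?N = to_vec2 ` \<Phi> ` (ball 0 1 \<inter> {z. Im z = 0})"
    by (auto simp: image_image)
  finally show ?thesis .
qed

text \<open>The integrand of the area integral of \<open>h\<close> after substituting \<open>\<Phi>\<close> composed with polar coordinates.\<close>

definition polar_pullback :: "(complex \<Rightarrow> complex) \<Rightarrow> (complex \<Rightarrow> real) \<Rightarrow> real ^ 2 \<Rightarrow> real"
  where "polar_pullback \<Phi> h x = h (\<Phi> (polar x)) * (norm (deriv \<Phi> (polar x)))\<^sup>2 * x$1"

lemma open_polar_rect: "open polar_rect"
proof -
  have "polar_rect = {x. 0 < x$1} \<inter> {x. x$1 < 1} \<inter> {x. 0 < x$2} \<inter> {x. x$2 < 2*pi}"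
    by (auto simp: polar_rect_def)
  also have "open \<dots>"
    by (intro open_Int open_Collect_less continuous_intros)
  finally show ?thesis .
qed

text \<open>Polar coordinates miss a slit of the disc, whose image under \<open>\<Phi>\<close> is negligible.\<close>

lemma change_of_variables_polar_pullback:
  assumes hol: "\<Phi> holomorphic_on ball 0 1" and inj: "inj_on \<Phi> (ball 0 1)"
    and im: "\<Phi> ` ball 0 1 = ball 0 1"
  shows "polar_pullback \<Phi> h absolutely_integrable_on polar_rect \<and> integral polar_rect (polar_pullback \<Phi> h) = b
     \<longleftrightarrow> (h \<circ> of_vec2) absolutely_integrable_on (to_vec2 ` ball 0 1) \<and> integral (to_vec2 ` ball 0 1) (h \<circ> of_vec2) = b"
proof -
  let ?g = "\<lambda>x. to_vec2 (\<Phi> (polar x))"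
  let ?g' = "\<lambda>x h. to_vec2 (deriv \<Phi> (polar x) * (cis (x$2) * (of_real (h$1) + \<i> * of_real (x$1 * h$2))))"
  let ?f = "\<lambda>x. vec (h (of_vec2 x)) :: real ^ 1"
  have S: "polar_rect \<in> sets lebesgue"
    by (rule sets_completionI_sets) (simp add: open_polar_rect)
  have der: "(?g has_derivative ?g' x) (at x within polar_rect)" if "x \<in> polar_rect" for x
  proof -
    have "polar x \<in> ball 0 1" using polar_image(1) that by blast
    then have "(\<Phi> has_field_derivative deriv \<Phi> (polar x)) (at (polar x))"
      using hol by (simp add: holomorphic_derivI)
    then have D: "(\<Phi> has_derivative (\<lambda>h. deriv \<Phi> (polar x) * h)) (at (polar x))"
      by (simp add: has_field_derivative_def)
    show ?thesis
      by (rule has_derivative_to_vec2[OF has_derivative_compose[OF has_derivative_polar D]])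
  qed
  have injg: "inj_on ?g polar_rect"
  proof (rule inj_onI)
    fix x y assume xy: "x \<in> polar_rect" "y \<in> polar_rect" "?g x = ?g y"
    then have "\<Phi> (polar x) = \<Phi> (polar y)" by (metis of_to_vec2)
    then have "polar x = polar y"
      using inj xy polar_image(1) by (auto simp: inj_on_def)
    then show "x = y" using polar_eq_iff xy by blast
  qed
  have det: "\<bar>det (matrix (?g' x))\<bar> *\<^sub>R ?f (?g x) = vec (polar_pullback \<Phi> h x)" if "x \<in> polar_rect" for x
    unfolding det_holomorphic_polar
    using that by (simp add: polar_pullback_def vec_eq_iff polar_rect_def abs_mult)
  have diff: "negligible (sym_diff (to_vec2 ` ball 0 1) (?g ` polar_rect))"
  proof (rule negligible_subset[OF negligible_holomorphic_image[OF hol]])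
    show "sym_diff (to_vec2 ` ball 0 1) (?g ` polar_rect) \<subseteq> to_vec2 ` \<Phi> ` (ball 0 1 \<inter> {z. Im z = 0})"
    proof
      fix y assume y: "y \<in> sym_diff (to_vec2 ` ball 0 1) (?g ` polar_rect)"
      have "?g ` polar_rect \<subseteq> to_vec2 ` ball 0 1"
        using polar_image(1) im by auto
      with y have y': "y \<in> to_vec2 ` ball 0 1" "y \<notin> ?g ` polar_rect" by auto
      then obtain z where z: "z \<in> ball 0 1" "y = to_vec2 (\<Phi> z)" using im by (metis (no_types, lifting) imageE)
      then have "z \<notin> polar ` polar_rect" using y'(2) by auto
      then show "y \<in> to_vec2 ` \<Phi> ` (ball 0 1 \<inter> {z. Im z = 0})"
        using z polar_image(2) by auto
    qed
  qed
  have vec_int: "(\<lambda>x. vec (k x) :: real^1) absolutely_integrable_on A \<and> integral A (\<lambda>x. vec (k x) :: real^1) = vec b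
      \<longleftrightarrow> k absolutely_integrable_on A \<and> integral A k = b" for k :: "real^2 \<Rightarrow> real" and A b
  proof -
    have "(\<lambda>x. vec (k x) :: real^1) absolutely_integrable_on A \<longleftrightarrow> k absolutely_integrable_on A"
      by (subst absolutely_integrable_componentwise_iff)
         (simp add: Basis_vec_def inner_axis)
    moreover have "integral A (\<lambda>x. vec (k x) :: real^1) = vec (integral A k)"
      if "k absolutely_integrable_on A"
    proof (rule integral_unique, subst has_integral_componentwise_iff)
      show "\<forall>b\<in>Basis. ((\<lambda>x. vec (k x) \<bullet> b) has_integral (vec (integral A k) :: real^1) \<bullet> b) A"
        using that by (auto simp: Basis_vec_def inner_axis absolutely_integrable_on_def)
    qed
    ultimately show ?thesis by (auto simp: vec_eq_iff)
  qed
  have "polar_pullback \<Phi> h absolutely_integrable_on polar_rect \<and> integral polar_rect (polar_pullback \<Phi> h) = b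
    \<longleftrightarrow> (\<lambda>x. \<bar>det (matrix (?g' x))\<bar> *\<^sub>R ?f (?g x)) absolutely_integrable_on polar_rect \<and>
        integral polar_rect (\<lambda>x. \<bar>det (matrix (?g' x))\<bar> *\<^sub>R ?f (?g x)) = vec b"
    unfolding vec_int[symmetric]
    using det by (simp cong: integral_cong set_integrable_cong)
  also have "\<dots> \<longleftrightarrow> ?f absolutely_integrable_on (?g ` polar_rect) \<and> integral (?g ` polar_rect) ?f = vec b"
    by (rule has_absolute_integral_change_of_variables[OF S der injg])
  also have "\<dots> \<longleftrightarrow> (h \<circ> of_vec2) absolutely_integrable_on (?g ` polar_rect) \<and> integral (?g ` polar_rect) (h \<circ> of_vec2) = b"
    unfolding o_def by (rule vec_int)
  also have "\<dots> \<longleftrightarrow> (h \<circ> of_vec2) absolutely_integrable_on (to_vec2 ` ball 0 1) \<and> integral (to_vec2 ` ball 0 1) (h \<circ> of_vec2) = b"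
  proof -
    have neg: "negligible (to_vec2 ` ball 0 1 - ?g ` polar_rect)" "negligible (?g ` polar_rect - to_vec2 ` ball 0 1)"
      using diff by (auto simp: negligible_Un_eq)
    have "(h \<circ> of_vec2) absolutely_integrable_on (?g ` polar_rect) \<longleftrightarrow> (h \<circ> of_vec2) absolutely_integrable_on (to_vec2 ` ball 0 1)"
      by (rule absolutely_integrable_spike_set_eq) (auto intro: negligible_subset[OF neg(1)] negligible_subset[OF neg(2)])
    moreover have "integral (?g ` polar_rect) (h \<circ> of_vec2) = integral (to_vec2 ` ball 0 1) (h \<circ> of_vec2)"
      by (rule integral_spike_set) (auto intro: negligible_subset[OF neg(1)] negligible_subset[OF neg(2)])
    ultimately show ?thesis by simp
  qed
  finally show ?thesis .
qed


lemma continuous_on_polar: "continuous_on S polar"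
  by (rule has_derivative_continuous_on) (rule has_derivative_polar)

lemma continuous_on_polar_pullback:
  assumes hol: "\<Phi> holomorphic_on ball 0 1" and im: "\<Phi> ` ball 0 1 = ball 0 1"
    and h: "continuous_on (ball 0 1) h"
  shows "continuous_on polar_rect (polar_pullback \<Phi> h)"
proof -
  have 1: "continuous_on polar_rect (\<lambda>x. \<Phi> (polar x))"
    by (rule continuous_on_compose2[OF holomorphic_on_imp_continuous_on[OF hol] continuous_on_polar polar_image(1)])
  have 2: "continuous_on polar_rect (\<lambda>x. deriv \<Phi> (polar x))"
    by (rule continuous_on_compose2[OF holomorphic_on_imp_continuous_on[OF holomorphic_deriv[OF hol open_ball]] 
        continuous_on_polar polar_image(1)])
  have "continuous_on polar_rect (\<lambda>x. h (\<Phi> (polar x)))"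
    by (rule continuous_on_compose2[OF h 1]) (use polar_image(1) im in blast)
  then show ?thesis
    unfolding polar_pullback_def by (intro continuous_intros 2)
qed

lemma nn_integral_polar_pullback:
  assumes hol: "\<Phi> holomorphic_on ball 0 1" and im: "\<Phi> ` ball 0 1 = ball 0 1"
    and h: "continuous_on (ball 0 1) h"
  shows "(\<integral>\<^sup>+x\<in>polar_rect. ennreal (polar_pullback \<Phi> h x) \<partial>lborel) =
    (\<integral>\<^sup>+r\<in>{0<..<1}. (\<integral>\<^sup>+t\<in>{0<..<2*pi}.
       ennreal (h (\<Phi> (of_real r * cis t)) * (norm (deriv \<Phi> (of_real r * cis t)))\<^sup>2 * r) \<partial>lborel) \<partial>lborel)"
proof -
  have [measurable]: "(\<lambda>x. ennreal (polar_pullback \<Phi> h x) * indicator polar_rect x) \<in> borel_measurable borel"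
  proof -
    have "(\<lambda>x. indicator polar_rect x *\<^sub>R polar_pullback \<Phi> h x) \<in> borel_measurable borel"
      by (rule borel_measurable_continuous_on_indicator)
         (use open_polar_rect continuous_on_polar_pullback[OF assms] in auto)
    then have "(\<lambda>x. ennreal (indicator polar_rect x *\<^sub>R polar_pullback \<Phi> h x)) \<in> borel_measurable borel"
      by measurable
    also have "(\<lambda>x. ennreal (indicator polar_rect x *\<^sub>R polar_pullback \<Phi> h x)) =
       (\<lambda>x. ennreal (polar_pullback \<Phi> h x) * indicator polar_rect x)"
      by (auto simp: indicator_def)
    finally show ?thesis .
  qed
  show ?thesis
    by (subst nn_integral_vec2, measurable)
       (auto intro!: nn_integral_cong simp: polar_rect_def polar_pullback_def polar_def indicator_def)
qed

text \<open>For every automorphism \<open>\<Phi>\<close> the left-hand side is the area integral of \<open>h\<close> over the disc, which does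
  not depend on \<open>\<Phi>\<close>; the right-hand side is the case of the identity map.\<close>

lemma polar_integral_invariant:
  assumes hol: "\<Phi> holomorphic_on ball 0 1" and inj: "inj_on \<Phi> (ball 0 1)"
    and im: "\<Phi> ` ball 0 1 = ball 0 1"
    and h: "continuous_on (ball 0 1) h" and nonneg: "\<And>z. z \<in> ball 0 1 \<Longrightarrow> 0 \<le> h z"
    and fin: "(\<integral>\<^sup>+r\<in>{0<..<1}. (\<integral>\<^sup>+t\<in>{0<..<2*pi}. ennreal (h (of_real r * cis t) * r) \<partial>lborel) \<partial>lborel) < \<infinity>"
  shows "(\<integral>\<^sup>+r\<in>{0<..<1}. (\<integral>\<^sup>+t\<in>{0<..<2*pi}.
       ennreal (h (\<Phi> (of_real r * cis t)) * (norm (deriv \<Phi> (of_real r * cis t)))\<^sup>2 * r) \<partial>lborel) \<partial>lborel) =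
    (\<integral>\<^sup>+r\<in>{0<..<1}. (\<integral>\<^sup>+t\<in>{0<..<2*pi}. ennreal (h (of_real r * cis t) * r) \<partial>lborel) \<partial>lborel)"
proof -
  have id: "id holomorphic_on ball 0 1" "inj_on id (ball 0 1)" "id ` ball 0 1 = (ball 0 1 :: complex set)"
    by auto
  have pos: "0 \<le> polar_pullback \<Psi> h x" if "x \<in> polar_rect" "\<Psi> ` ball 0 1 = ball 0 1" for \<Psi> x
  proof -
    have "\<Psi> (polar x) \<in> ball 0 1" using polar_image(1) that by blast
    then show ?thesis using that nonneg by (auto simp: polar_pullback_def polar_rect_def)
  qed
  have nn: "(\<integral>\<^sup>+x\<in>polar_rect. ennreal (polar_pullback id h x) \<partial>lborel) =
      (\<integral>\<^sup>+r\<in>{0<..<1}. (\<integral>\<^sup>+t\<in>{0<..<2*pi}. ennreal (h (of_real r * cis t) * r) \<partial>lborel) \<partial>lborel)"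
    by (subst nn_integral_polar_pullback[OF id(1,3) h]) simp
  have "integrable lborel (\<lambda>x. indicator polar_rect x *\<^sub>R polar_pullback id h x)"
  proof (rule integrableI_bounded)
    have "(\<lambda>x. indicator polar_rect x *\<^sub>R polar_pullback id h x) \<in> borel_measurable borel"
      by (rule borel_measurable_continuous_on_indicator)
         (use open_polar_rect continuous_on_polar_pullback[OF id(1,3) h] in auto)
    then show meas: "(\<lambda>x. indicator polar_rect x *\<^sub>R polar_pullback id h x) \<in> borel_measurable lborel"
      by simp
    have "(\<integral>\<^sup>+x. ennreal (norm (indicator polar_rect x *\<^sub>R polar_pullback id h x)) \<partial>lborel) =
        (\<integral>\<^sup>+x\<in>polar_rect. ennreal (polar_pullback id h x) \<partial>lborel)"
      by (intro nn_integral_cong) (auto simp: indicator_def pos id(3))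
    then show "(\<integral>\<^sup>+x. ennreal (norm (indicator polar_rect x *\<^sub>R polar_pullback id h x)) \<partial>lborel) < \<infinity>"
      using nn fin by simp
  qed
  then have ai: "polar_pullback id h absolutely_integrable_on polar_rect"
    unfolding set_integrable_def
    by (subst integrable_completion) (auto dest: borel_measurable_integrable)
  define b where "b = integral polar_rect (polar_pullback id h)"
  have "polar_pullback \<Phi> h absolutely_integrable_on polar_rect \<and> integral polar_rect (polar_pullback \<Phi> h) = b"
    using ai change_of_variables_polar_pullback[OF id, of h b] change_of_variables_polar_pullback[OF hol inj im, of h b]
    by (simp add: b_def)
  then have "(polar_pullback \<Phi> h has_integral b) polar_rect"
    by (auto simp: absolutely_integrable_on_def has_integral_iff)
  moreover have "(polar_pullback id h has_integral b) polar_rect"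
    using ai by (auto simp: absolutely_integrable_on_def has_integral_iff b_def)
  ultimately have "(\<integral>\<^sup>+x\<in>polar_rect. ennreal (polar_pullback \<Phi> h x) \<partial>lborel) =
     (\<integral>\<^sup>+x\<in>polar_rect. ennreal (polar_pullback id h x) \<partial>lborel)"
    using nn_integral_has_integral_lebesgue'[of polar_rect "polar_pullback \<Phi> h" b]
      nn_integral_has_integral_lebesgue'[of polar_rect "polar_pullback id h" b] pos im id(3) by simp
  then show ?thesis
    unfolding nn nn_integral_polar_pullback[OF hol im h] .
qed

section \<open>Functions with a zero for \<open>1 < \<alpha>\<close>\<close>

text \<open>The negative of the derivative of \<open>(1 - r\<^sup>2)\<^sup>\<alpha>\<^sup>-\<^sup>1\<close>, a probability density on the unit interval if \<open>\<alpha> > 1\<close>.\<close>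

definition radial_weight :: "real \<Rightarrow> real \<Rightarrow> real"
  where "radial_weight \<alpha> r = 2 * (\<alpha> - 1) * r * (1 - r\<^sup>2) powr (\<alpha> - 2)"

lemma radial_weight_nonneg: "1 \<le> \<alpha> \<Longrightarrow> 0 \<le> r \<Longrightarrow> 0 \<le> radial_weight \<alpha> r"
  by (simp add: radial_weight_def)

lemma borel_measurable_radial_weight [measurable]: "radial_weight \<alpha> \<in> borel_measurable borel"
  unfolding radial_weight_def by measurable

lemma nn_integral_radial_weight:
  assumes \<alpha>: "1 < \<alpha>" and s: "0 \<le> s" "s < 1"
  shows "(\<integral>\<^sup>+r\<in>{s<..<1}. ennreal (radial_weight \<alpha> r) \<partial>lborel) = ennreal ((1 - s\<^sup>2) powr (\<alpha> - 1))"
proof -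
  have "(radial_weight \<alpha> has_integral (- ((1 - 1\<^sup>2) powr (\<alpha> - 1)) - (- ((1 - s\<^sup>2) powr (\<alpha> - 1))))) {s..1}"
  proof (rule fundamental_theorem_of_calculus_interior)
    show "continuous_on {s..1} (\<lambda>r. - ((1 - r\<^sup>2) powr (\<alpha> - 1)))"
      using \<alpha> s by (intro continuous_intros continuous_on_powr') (auto simp: power_le_one)
    show "((\<lambda>r. - ((1 - r\<^sup>2) powr (\<alpha> - 1))) has_vector_derivative radial_weight \<alpha> r) (at r)"
      if "r \<in> {s<..<1}" for r
    proof -
      have "r\<^sup>2 < 1" using that s by (simp add: power_less_one_iff)
      then show ?thesis
        unfolding has_real_derivative_iff_has_vector_derivative[symmetric]
        by (auto intro!: derivative_eq_intros simp: radial_weight_def diff_diff_eq)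
    qed
  qed (use s in simp)
  then have "(radial_weight \<alpha> has_integral ((1 - s\<^sup>2) powr (\<alpha> - 1))) {s<..<1}"
    unfolding has_integral_Icc_iff_Ioo[symmetric] using \<alpha> by simp
  then show ?thesis
    by (intro nn_integral_has_integral_lebesgue') (use \<alpha> s in \<open>auto intro: radial_weight_nonneg\<close>)
qed

lemma borel_measurable_mean_weight:
  assumes hol: "f holomorphic_on ball 0 1" and p: "0 < p"
  shows "(\<lambda>r. ennreal (integral_mean_pow p r f * radial_weight \<alpha> r) * indicator {0<..<1} r) \<in> borel_measurable borel"
proof -
  have sq: "r\<^sup>2 < 1" if "r \<in> {0<..<1}" for r :: real
    using that by (simp add: power_less_one_iff)
  have "continuous_on {0<..<1} (\<lambda>r. integral_mean_pow p r f * radial_weight \<alpha> r)"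
  proof (rule continuous_on_mult)
    show "continuous_on {0<..<1} (\<lambda>r. integral_mean_pow p r f)"
      by (rule continuous_on_subset[OF continuous_on_integral_mean_pow[OF holomorphic_on_imp_continuous_on[OF hol] p]]) auto
    show "continuous_on {0<..<1} (radial_weight \<alpha>)"
      unfolding radial_weight_def using sq by (intro continuous_intros) force+
  qed
  then have "(\<lambda>r. indicator {0<..<1} r *\<^sub>R (integral_mean_pow p r f * radial_weight \<alpha> r)) \<in> borel_measurable borel"
    by (intro borel_measurable_continuous_on_indicator) auto
  then have "(\<lambda>r. ennreal (indicator {0<..<1} r *\<^sub>R (integral_mean_pow p r f * radial_weight \<alpha> r))) \<in> borel_measurable borel"
    by measurable
  also have "(\<lambda>r. ennreal (indicator {0<..<1} r *\<^sub>R (integral_mean_pow p r f * radial_weight \<alpha> r))) =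
      (\<lambda>r. ennreal (integral_mean_pow p r f * radial_weight \<alpha> r) * indicator {0<..<1} r)"
    by (auto simp: indicator_def)
  finally show ?thesis .
qed

text \<open>Integration by parts on the interval from \<open>0\<close> to \<open>R\<close>, dropping the nonnegative boundary term at \<open>R\<close>, and monotone
  convergence as \<open>R \<rightarrow> 1\<close>.\<close>

lemma wnorm_pow_ge_weighted_mean:
  assumes \<alpha>: "1 < \<alpha>" and p: "0 < p" and hol: "f holomorphic_on ball 0 1"
    and nz: "b \<in> ball 0 1" "f b \<noteq> 0"
  shows "(\<integral>\<^sup>+r\<in>{0<..<1}. ennreal (integral_mean_pow p r f * radial_weight \<alpha> r) \<partial>lborel) \<le> wnorm_pow \<alpha> p f"
proof -
  let ?k = "\<lambda>r. integral_mean_pow p r f * radial_weight \<alpha> r"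
  have le: "(\<integral>\<^sup>+r\<in>{0<..<R}. ennreal (?k r) \<partial>lborel) \<le> wnorm_pow \<alpha> p f" if R: "0 < R" "R < 1" for R
  proof -
    note bp = radial_energy_by_parts[OF hol R order_refl p nz, of \<alpha>]
    have eq: "(\<lambda>r. integral_mean_pow p r f * ((\<alpha> - 1) * (1 - r\<^sup>2) powr (\<alpha> - 2) * (- 2 * r))) = (\<lambda>r. - ?k r)"
      by (auto simp: radial_weight_def)
    have cont: "continuous_on {0..R} ?k"
      using continuous_on_minus[OF bp(2)[unfolded eq]] by (simp only: minus_minus)
    then have "(?k has_integral integral {0..R} ?k) {0..R}"
      by (intro integrable_integral integrable_continuous_real)
    then have "(?k has_integral integral {0..R} ?k) {0<..<R}"
      unfolding has_integral_Icc_iff_Ioo .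
    then have "(\<integral>\<^sup>+r\<in>{0<..<R}. ennreal (?k r) \<partial>lborel) = ennreal (integral {0..R} ?k)"
      by (intro nn_integral_has_integral_lebesgue')
         (use \<alpha> in \<open>auto intro!: mult_nonneg_nonneg integral_mean_pow_nonneg radial_weight_nonneg\<close>)
    also have "\<dots> \<le> radial_energy \<alpha> p R f"
      unfolding bp(1) eq by (intro ennreal_leI) (simp add: integral_mean_pow_nonneg)
    also have "\<dots> \<le> wnorm_pow \<alpha> p f"
      unfolding wnorm_pow_eq_radial_energy by (rule radial_energy_mono) (use R in simp)
    finally show ?thesis .
  qed
  \<comment> \<open>a sequence of positive radii increasing to \<open>1\<close>\<close>
  define R where "R n = 1 - 1 / real (n + 2)" for n
  have R: "0 < R n" "R n < 1" for n by (auto simp: R_def field_simps)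
  have "incseq R" unfolding R_def by (intro incseq_SucI) (simp add: field_simps)
  let ?K = "\<lambda>r. ennreal (?k r) * indicator {0<..<1} r"
  have "?K r = (SUP n. ?K r * indicator {0<..<R n} r)" for r
  proof (cases "r \<in> {0<..<1}")
    case True
    obtain n :: nat where "1 / (1 - r) < real n" using reals_Archimedean2 by blast
    then have "r < R n" using True by (simp add: R_def field_simps)
    then have "?K r = ?K r * indicator {0<..<R n} r" using True by simp
    also have "\<dots> \<le> (SUP n. ?K r * indicator {0<..<R n} r)" by (rule SUP_upper) simp
    finally have "?K r \<le> (SUP n. ?K r * indicator {0<..<R n} r)" .
    moreover have "(SUP n. ?K r * indicator {0<..<R n} r) \<le> ?K r"
      by (intro SUP_least) (auto simp: indicator_def)
    ultimately show ?thesis by (rule antisym)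
  qed simp
  then have "(\<integral>\<^sup>+r. ?K r \<partial>lborel) = (\<integral>\<^sup>+r. (SUP n. ?K r * indicator {0<..<R n} r) \<partial>lborel)"
    by presburger
  also have "\<dots> = (SUP n. \<integral>\<^sup>+r. ?K r * indicator {0<..<R n} r \<partial>lborel)"
  proof (rule nn_integral_monotone_convergence_SUP)
    show "incseq (\<lambda>n r. ?K r * indicator {0<..<R n} r)"
      using \<open>incseq R\<close> by (force simp: incseq_def le_fun_def indicator_def)
    show "(\<lambda>r. ?K r * indicator {0<..<R n} r) \<in> borel_measurable lborel" for n
      using borel_measurable_mean_weight[OF hol p, of \<alpha>] by measurable
  qed
  also have "\<dots> \<le> wnorm_pow \<alpha> p f"
  proof (rule SUP_least)
    fix n
    have "(\<integral>\<^sup>+r. ?K r * indicator {0<..<R n} r \<partial>lborel) = (\<integral>\<^sup>+r\<in>{0<..<R n}. ennreal (?k r) \<partial>lborel)"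
      using R[of n] by (intro nn_integral_cong) (auto simp: indicator_def)
    also have "\<dots> \<le> wnorm_pow \<alpha> p f" by (rule le[OF R])
    finally show "(\<integral>\<^sup>+r. ?K r * indicator {0<..<R n} r \<partial>lborel) \<le> wnorm_pow \<alpha> p f" .
  qed
  finally show ?thesis .
qed

lemma AE_zero_free_radius:
  assumes hol: "f holomorphic_on ball 0 1" and nz: "b \<in> ball 0 1" "f b \<noteq> 0"
  shows "AE r in lborel. r \<in> {0<..<1} \<longrightarrow> (\<forall>z. norm z = r \<longrightarrow> f z \<noteq> 0)"
proof -
  let ?Z = "\<Union>n. norm ` {z \<in> cball 0 (1 - 1 / real (n + 2)). f z = 0}"
  have "countable ?Z"
    by (rule countable_UN, simp, rule countable_finite, rule finite_zero_radii[OF hol _ nz], simp)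
  then have "AE r in lborel. r \<notin> ?Z"
    by (intro AE_not_in countable_imp_null_set_lborel)
  then show ?thesis
  proof eventually_elim
    fix r :: real assume r: "r \<notin> ?Z"
    show "r \<in> {0<..<1} \<longrightarrow> (\<forall>z. norm z = r \<longrightarrow> f z \<noteq> 0)"
    proof (intro impI allI notI)
      fix z assume *: "r \<in> {0<..<1}" "norm z = r" "f z = 0"
      obtain n :: nat where "1 / (1 - r) < real n" using reals_Archimedean2 by blast
      then have "r \<le> 1 - 1 / real (n + 2)" using *(1) by (simp add: field_simps)
      then have "r \<in> ?Z" using * by (intro UN_I[of n]) auto
      then show False using r by simp
    qed
  qed
qed

lemma integral_mean_pow_ge_of_zero:
  assumes hol: "f holomorphic_on ball 0 1" and p: "0 < p" and R: "R < 1" "\<And>z. norm z = R \<Longrightarrow> f z \<noteq> 0"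
    and a: "norm a < R" "f a = 0" "a \<noteq> 0"
  shows "(norm (f 0) * R / norm a) powr p \<le> integral_mean_pow p R f"
proof -
  have "0 < R" using a(1) by (meson norm_ge_zero le_less_trans)
  obtain g \<rho> where g: "R < \<rho>" "g holomorphic_on ball 0 \<rho>" "\<And>z. z \<in> ball 0 \<rho> \<Longrightarrow> g z \<noteq> 0"
    "\<And>z. norm z = R \<Longrightarrow> norm (f z) = norm (g z)"
    "\<And>z. norm z < R \<Longrightarrow> norm (f z) \<le> norm (of_real R * (z - a) / (of_real (R\<^sup>2) - cnj a * z)) * norm (g z)"
    using blaschke_factorization_at_zero[OF hol \<open>0 < R\<close> R a(1,2)] by metis
  have "norm (f 0) \<le> norm a / R * norm (g 0)"
    using g(5)[of 0] \<open>0 < R\<close> by (simp add: norm_mult norm_divide power2_eq_square)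
  then have "norm (f 0) * R / norm a \<le> norm (g 0)"
    using \<open>0 < R\<close> a(3) by (simp add: field_simps)
  then have "(norm (f 0) * R / norm a) powr p \<le> norm (g 0) powr p"
    using p \<open>0 < R\<close> by (intro powr_mono2) auto
  also have "\<dots> = integral_mean_pow p 0 g" by (simp add: integral_mean_pow_0)
  also have "\<dots> \<le> integral_mean_pow p R g"
    by (rule integral_mean_pow_zero_free_mono[OF g(2,3)]) (use g \<open>0 < R\<close> in auto)
  also have "\<dots> = integral_mean_pow p R f"
    using \<open>0 < R\<close> by (intro integral_mean_pow_cong) (simp add: g(4))
  finally show ?thesis .
qed

text \<open>All circular means are at least the value at the center, and beyond a radius \<open>s > |a|\<close> they exceed it
  by a fixed amount.\<close>

lemma weighted_mean_gt_center:
  assumes \<alpha>: "1 < \<alpha>" and p: "0 < p" and hol: "f holomorphic_on ball 0 1"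
    and f0: "f 0 \<noteq> 0" and a: "norm a < 1" "f a = 0"
  shows "ennreal (norm (f 0) powr p) <
    (\<integral>\<^sup>+r\<in>{0<..<1}. ennreal (integral_mean_pow p r f * radial_weight \<alpha> r) \<partial>lborel)"
proof -
  have "a \<noteq> 0" using a f0 by auto
  obtain s where s: "norm a < s" "s < 1" using a dense by blast
  then have "0 < s" by (meson norm_ge_zero le_less_trans)
  define A where "A = norm (f 0) powr p"
  define B where "B = (norm (f 0) * s / norm a) powr p - A"
  have "norm (f 0) < norm (f 0) * s / norm a"
    using s(1) \<open>a \<noteq> 0\<close> f0 by (simp add: field_simps)
  then have B: "0 < B" unfolding A_def B_def using p f0 by (simp add: powr_less_mono2)
  have ss: "s\<^sup>2 < 1" using s \<open>0 < s\<close> by (simp add: power_less_one_iff)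
  have A: "0 \<le> A" by (simp add: A_def)
  have "ennreal A < ennreal (A + B * (1 - s\<^sup>2) powr (\<alpha> - 1))"
    using A B ss by (intro ennreal_lessI) (auto intro: add_nonneg_pos)
  also have "\<dots> = ennreal A * (\<integral>\<^sup>+r\<in>{0<..<1}. ennreal (radial_weight \<alpha> r) \<partial>lborel) +
      ennreal B * (\<integral>\<^sup>+r\<in>{s<..<1}. ennreal (radial_weight \<alpha> r) \<partial>lborel)"
    using nn_integral_radial_weight[OF \<alpha>, of 0] nn_integral_radial_weight[OF \<alpha>, of s] s \<open>0 < s\<close> A B
    by (simp add: ennreal_plus ennreal_mult)
  also have "\<dots> = (\<integral>\<^sup>+r. ennreal A * (ennreal (radial_weight \<alpha> r) * indicator {0<..<1} r) +
      ennreal B * (ennreal (radial_weight \<alpha> r) * indicator {s<..<1} r) \<partial>lborel)"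
    by (subst nn_integral_add) (simp_all add: nn_integral_cmult)
  also have "\<dots> \<le> (\<integral>\<^sup>+r\<in>{0<..<1}. ennreal (integral_mean_pow p r f * radial_weight \<alpha> r) \<partial>lborel)"
  proof (rule nn_integral_mono_AE)
    have "AE r in lborel. r \<in> {0<..<1} \<longrightarrow> (\<forall>z. norm z = r \<longrightarrow> f z \<noteq> 0)"
      by (rule AE_zero_free_radius[OF hol, of 0]) (use f0 in auto)
    then show "AE r in lborel. ennreal A * (ennreal (radial_weight \<alpha> r) * indicator {0<..<1} r) +
      ennreal B * (ennreal (radial_weight \<alpha> r) * indicator {s<..<1} r) \<le>
      ennreal (integral_mean_pow p r f * radial_weight \<alpha> r) * indicator {0<..<1} r"
    proof eventually_elim
      fix r :: real assume good: "r \<in> {0<..<1} \<longrightarrow> (\<forall>z. norm z = r \<longrightarrow> f z \<noteq> 0)"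
      show "ennreal A * (ennreal (radial_weight \<alpha> r) * indicator {0<..<1} r) +
        ennreal B * (ennreal (radial_weight \<alpha> r) * indicator {s<..<1} r) \<le>
        ennreal (integral_mean_pow p r f * radial_weight \<alpha> r) * indicator {0<..<1} r"
      proof (cases "r \<in> {0<..<1}")
        case False
        then show ?thesis using \<open>0 < s\<close> by (auto simp: indicator_def)
      next
        case r: True
        have w: "0 \<le> radial_weight \<alpha> r" using r \<alpha> by (auto intro: radial_weight_nonneg)
        show ?thesis
        proof (cases "s < r")
          case True
          have "A + B = (norm (f 0) * s / norm a) powr p" by (simp add: B_def)
          also have "\<dots> \<le> (norm (f 0) * r / norm a) powr p"
            using p True \<open>0 < s\<close> by (intro powr_mono2 divide_right_mono mult_left_mono) auto
          also have "\<dots> \<le> integral_mean_pow p r f"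
            by (rule integral_mean_pow_ge_of_zero[OF hol p]) (use r good True s a \<open>a \<noteq> 0\<close> in auto)
          finally have "(A + B) * radial_weight \<alpha> r \<le> integral_mean_pow p r f * radial_weight \<alpha> r"
            by (rule mult_right_mono[OF _ w])
          then have "ennreal ((A + B) * radial_weight \<alpha> r) \<le> ennreal (integral_mean_pow p r f * radial_weight \<alpha> r)"
            by (rule ennreal_leI)
          then show ?thesis using r True A B w by (simp add: ennreal_mult ennreal_plus distrib_right)
        next
          case False
          have "A = integral_mean_pow p 0 f" by (simp add: A_def integral_mean_pow_0)
          also have "\<dots> \<le> integral_mean_pow p r f"
            by (rule integral_mean_pow_mono[OF hol p]) (use r good in auto)
          finally have "A * radial_weight \<alpha> r \<le> integral_mean_pow p r f * radial_weight \<alpha> r"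
            by (rule mult_right_mono[OF _ w])
          then have "ennreal (A * radial_weight \<alpha> r) \<le> ennreal (integral_mean_pow p r f * radial_weight \<alpha> r)"
            by (rule ennreal_leI)
          then show ?thesis using r False A w by (simp add: ennreal_mult)
        qed
      qed
    qed
  qed
  finally show ?thesis by (simp add: A_def)
qed

lemma mean_weight_eq_circle_integral:
  assumes hol: "f holomorphic_on ball 0 1" and p: "0 < p" and \<alpha>: "1 < \<alpha>" and r: "0 < r" "r < 1"
  shows "ennreal (integral_mean_pow p r f * radial_weight \<alpha> r) =
    (\<integral>\<^sup>+t\<in>{0<..<2*pi}. ennreal ((\<alpha> - 1) / pi * norm (f (of_real r * cis t)) powr p * (1 - r\<^sup>2) powr (\<alpha> - 2) * r) \<partial>lborel)"
proof -
  have "continuous_on {0..2*pi} (\<lambda>t. f (of_real r * exp (\<i> * of_real t)))"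
    by (rule continuous_on_compose2[OF holomorphic_on_imp_continuous_on[OF hol]])
       (use r in \<open>auto intro!: continuous_intros simp: norm_mult\<close>)
  then have "continuous_on {0..2*pi} (\<lambda>t. norm (f (of_real r * exp (\<i> * of_real t))) powr p / (2*pi))"
    using p by (intro continuous_on_divide continuous_on_powr' continuous_on_norm continuous_on_const) auto
  then have "((\<lambda>t. norm (f (of_real r * exp (\<i> * of_real t))) powr p / (2*pi)) has_integral integral_mean_pow p r f) {0..2*pi}"
    unfolding integral_mean_pow_def by (intro integrable_integral integrable_continuous_real)
  from has_integral_mult_left[OF this, of "radial_weight \<alpha> r"]
  have "((\<lambda>t. norm (f (of_real r * cis t)) powr p / (2*pi) * radial_weight \<alpha> r) has_integral
      (integral_mean_pow p r f * radial_weight \<alpha> r)) {0<..<2*pi}"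
    unfolding has_integral_Icc_iff_Ioo cis_conv_exp .
  also have "(\<lambda>t. norm (f (of_real r * cis t)) powr p / (2*pi) * radial_weight \<alpha> r) =
      (\<lambda>t. (\<alpha> - 1) / pi * norm (f (of_real r * cis t)) powr p * (1 - r\<^sup>2) powr (\<alpha> - 2) * r)"
    by (auto simp: radial_weight_def field_simps)
  finally show ?thesis
    by (intro nn_integral_has_integral_lebesgue'[symmetric]) (use \<alpha> r in auto)
qed

lemma Moebius_function_unit_disc:
  assumes w: "norm w < 1"
  shows "inj_on (Moebius_function 0 w) (ball 0 1)" "Moebius_function 0 w ` ball 0 1 = ball 0 1"
proof -
  have inv: "Moebius_function 0 (- w) (Moebius_function 0 w z) = z"
    "Moebius_function 0 w (Moebius_function 0 (- w) z) = z" if "norm z < 1" for z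
    using Moebius_function_compose[of "- w" w z] Moebius_function_compose[of w "- w" z] w that by auto
  show "inj_on (Moebius_function 0 w) (ball 0 1)"
    using inv(1) by (intro inj_on_inverseI[of _ "Moebius_function 0 (- w)"]) auto
  show "Moebius_function 0 w ` ball 0 1 = ball 0 1"
  proof
    show "Moebius_function 0 w ` ball 0 1 \<subseteq> ball 0 1"
      using Moebius_function_norm_lt_1 w by auto
    show "ball 0 1 \<subseteq> Moebius_function 0 w ` ball 0 1"
    proof
      fix z :: complex assume "z \<in> ball 0 1"
      then show "z \<in> Moebius_function 0 w ` ball 0 1"
        using inv(2)[of z] Moebius_function_norm_lt_1[of "- w" z 0] w
        by (intro image_eqI[of _ _ "Moebius_function 0 (- w) z"]) auto
    qed
  qed
qed

text \<open>The modulus of the derivative and the identity that compares \<open>1 - |\<Phi>(z)|\<^sup>2\<close> with \<open>1 - |z|\<^sup>2\<close>.\<close>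

lemma Moebius_function_deriv_norm:
  assumes w: "norm w < 1" and z: "norm z < 1"
  shows "norm (deriv (Moebius_function 0 w) z) = (1 - (norm w)\<^sup>2) / (norm (1 - cnj w * z))\<^sup>2"
    and "1 - (norm (Moebius_function 0 w z))\<^sup>2 = (1 - (norm w)\<^sup>2) * (1 - (norm z)\<^sup>2) / (norm (1 - cnj w * z))\<^sup>2"
proof -
  have nz: "1 - cnj w * z \<noteq> 0" by (rule Re_kernel_pos(2)[OF w z])
  have sq: "(norm w)\<^sup>2 < 1" using w by (simp add: power_less_one_iff)
  have "(Moebius_function 0 w has_field_derivative (1 - cnj w * w) / (1 - cnj w * z)\<^sup>2) (at z)"
    unfolding Moebius_function_simple[abs_def] using nz
    by (auto intro!: derivative_eq_intros simp: power2_eq_square algebra_simps)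
  then have "deriv (Moebius_function 0 w) z = (1 - cnj w * w) / (1 - cnj w * z)\<^sup>2"
    by (rule DERIV_imp_deriv)
  moreover have "1 - cnj w * w = of_real (1 - (norm w)\<^sup>2)"
    by (simp add: mult.commute[of "cnj w"] complex_norm_square[symmetric])
  ultimately show "norm (deriv (Moebius_function 0 w) z) = (1 - (norm w)\<^sup>2) / (norm (1 - cnj w * z))\<^sup>2"
    using sq by (simp only: norm_divide norm_of_real norm_power)
  have "(norm (1 - cnj w * z))\<^sup>2 - (norm (z - w))\<^sup>2 = (1 - (norm w)\<^sup>2) * (1 - (norm z)\<^sup>2)"
    using blaschke_factor_norm_diff[of 1 w z] by simp
  then show "1 - (norm (Moebius_function 0 w z))\<^sup>2 = (1 - (norm w)\<^sup>2) * (1 - (norm z)\<^sup>2) / (norm (1 - cnj w * z))\<^sup>2"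
    using nz by (simp add: Moebius_function_simple norm_divide power_divide field_simps)
qed

lemma wnorm_pow_strict_of_zero_gt_1:
  assumes \<alpha>: "1 < \<alpha>" and p: "0 < p" and hol: "f holomorphic_on ball 0 1"
    and w: "norm w < 1" "f w \<noteq> 0" and a: "norm a < 1" "f a = 0"
  shows "ennreal (norm (f w) powr p * (1 - (norm w)\<^sup>2) powr \<alpha>) < wnorm_pow \<alpha> p f"
proof -
  define \<Phi> where "\<Phi> = Moebius_function 0 (- w)"
  define x where "x = 1 - (norm w)\<^sup>2"
  \<comment> \<open>the function \<open>(f \<circ> \<Phi>) \<Phi>'\<^sup>\<alpha>\<^sup>/\<^sup>p\<close>, written with powers of the two factors of \<open>\<Phi>'\<close>\<close>
  define F where "F z = of_real (x powr (\<alpha> / p)) * (f (\<Phi> z) * (1 - cnj (- w) * z) powr (of_real (- 2 * \<alpha> / p)))" for z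
  define h where "h z = (\<alpha> - 1) / pi * norm (f z) powr p * (1 - (norm z)\<^sup>2) powr (\<alpha> - 2)" for z
  have w': "norm (- w) < 1" using w by simp
  have x: "0 < x" using w by (simp add: x_def power_less_one_iff)
  have hol\<Phi>: "\<Phi> holomorphic_on ball 0 1"
    unfolding \<Phi>_def by (rule Moebius_function_holomorphic[OF w'])
  note inj = Moebius_function_unit_disc(1)[OF w', folded \<Phi>_def]
  note im = Moebius_function_unit_disc(2)[OF w', folded \<Phi>_def]
  have holF: "F holomorphic_on ball 0 1"
    unfolding F_def
    by (intro holomorphic_intros kernel_powr_holomorphic[OF w']
        holomorphic_on_compose_gen[OF hol\<Phi> hol, unfolded o_def]) (simp add: im)
  have Fp: "norm (F z) powr p = x powr \<alpha> * (norm (f (\<Phi> z)) powr p * norm (1 - cnj (- w) * z) powr (- 2 * \<alpha>))"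
    if "norm z < 1" for z
  proof -
    have "1 - cnj (- w) * z \<noteq> 0" by (rule Re_kernel_pos(2)[OF w' that])
    from norm_powr_of_real[OF this, of "- 2 * \<alpha> / p"] show ?thesis
      using p x unfolding F_def by (simp only: norm_mult powr_mult norm_of_real) (simp add: powr_powr)
  qed
  have "\<Phi> 0 = w" by (simp add: \<Phi>_def Moebius_function_of_zero)
  then have F0: "norm (F 0) powr p = norm (f w) powr p * x powr \<alpha>" using Fp[of 0] by simp
  have "F 0 \<noteq> 0"
    using F0 w x by (metis mult_eq_0_iff norm_eq_zero powr_eq_0_iff less_irrefl)
  obtain a' where a': "norm a' < 1" "\<Phi> a' = a"
    using im a(1) by (metis (no_types, lifting) imageE mem_ball_0)
  then have "F a' = 0" using a(2) by (simp add: F_def)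
  \<comment> \<open>the Jacobian is absorbed by the identity \<open>1 - |\<Phi>(z)|\<^sup>2 = (1 - |z|\<^sup>2) |\<Phi>'(z)|\<close>\<close>
  have pull: "h (\<Phi> z) * (norm (deriv \<Phi> z))\<^sup>2 = (\<alpha> - 1) / pi * norm (F z) powr p * (1 - (norm z)\<^sup>2) powr (\<alpha> - 2)"
    if z: "norm z < 1" for z
  proof -
    define N where "N = norm (1 - cnj (- w) * z)"
    define y where "y = 1 - (norm z)\<^sup>2"
    have N: "0 < N" using Re_kernel_pos(2)[OF w' z] by (simp add: N_def)
    have y: "0 < y" using z by (simp add: y_def power_less_one_iff)
    have d: "norm (deriv \<Phi> z) = x / N\<^sup>2" "1 - (norm (\<Phi> z))\<^sup>2 = x * y / N\<^sup>2"
      using Moebius_function_deriv_norm[OF w' z] by (simp_all add: \<Phi>_def x_def N_def y_def)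
    have "(x * y / N\<^sup>2) powr (\<alpha> - 2) * (x / N\<^sup>2)\<^sup>2 = x powr \<alpha> * N powr (- 2 * \<alpha>) * y powr (\<alpha> - 2)"
    proof -
      have "(x / N\<^sup>2)\<^sup>2 = (x / N powr 2) powr 2" "N\<^sup>2 = N powr 2"
        using x N by (simp_all add: powr_numeral)
      then have "(x * y / N\<^sup>2) powr (\<alpha> - 2) * (x / N\<^sup>2)\<^sup>2 = (x * y / N powr 2) powr (\<alpha> - 2) * (x / N powr 2) powr 2"
        by simp
      also have "\<dots> = (x powr (\<alpha> - 2) * x powr 2) * (N powr (- 2 * (\<alpha> - 2)) * N powr (- 4)) * y powr (\<alpha> - 2)"
      proof -
        have "(x * y / N powr 2) powr (\<alpha> - 2) = x powr (\<alpha> - 2) * y powr (\<alpha> - 2) / (N powr 2) powr (\<alpha> - 2)"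
          using x y N by (simp only: powr_mult powr_divide)
        moreover have "(N powr 2) powr (\<alpha> - 2) = N powr (2 * (\<alpha> - 2))"
          by (rule powr_powr)
        moreover have "(x / N powr 2) powr 2 = x powr 2 / N powr (2 * 2)"
          using x N by (simp only: powr_divide powr_powr)
        moreover have "N powr (- 2 * (\<alpha> - 2)) = 1 / N powr (2 * (\<alpha> - 2))" "N powr (- 4) = 1 / N powr (2 * 2)"
          using powr_minus_divide[of N "2 * (\<alpha> - 2)"] powr_minus_divide[of N "2 * 2"] by simp_all
        ultimately show ?thesis by simp
      qed
      also have "\<dots> = x powr \<alpha> * N powr (- 2 * \<alpha>) * y powr (\<alpha> - 2)"
        by (simp flip: powr_add)
      finally show ?thesis .
    qed
    then show ?thesis
      unfolding h_def Fp[OF z] d N_def[symmetric] y_def[symmetric] by (simp add: mult_ac)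
  qed
  have cont_h: "continuous_on (ball 0 1) h"
  proof -
    have "(norm z)\<^sup>2 < 1" if "z \<in> ball 0 1" for z :: complex using that by (simp add: power_less_one_iff)
    then have c1: "continuous_on (ball 0 1) (\<lambda>z::complex. (1 - (norm z)\<^sup>2) powr (\<alpha> - 2))"
      by (intro continuous_intros) force+
    have c2: "continuous_on (ball 0 1) (\<lambda>z. norm (f z) powr p)"
      using p by (intro continuous_on_powr' continuous_on_norm continuous_on_const holomorphic_on_imp_continuous_on hol) auto
    show ?thesis unfolding h_def by (intro continuous_on_mult continuous_on_const c1 c2)
  qed
  have h0: "0 \<le> h z" for z using \<alpha> by (simp add: h_def)
  have J: "(\<integral>\<^sup>+r\<in>{0<..<1}. ennreal (integral_mean_pow p r f * radial_weight \<alpha> r) \<partial>lborel) =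
      (\<integral>\<^sup>+r\<in>{0<..<1}. (\<integral>\<^sup>+t\<in>{0<..<2*pi}. ennreal (h (of_real r * cis t) * r) \<partial>lborel) \<partial>lborel)"
  proof (rule nn_integral_cong)
    fix r :: real
    show "ennreal (integral_mean_pow p r f * radial_weight \<alpha> r) * indicator {0<..<1} r =
        (\<integral>\<^sup>+t\<in>{0<..<2*pi}. ennreal (h (of_real r * cis t) * r) \<partial>lborel) * indicator {0<..<1} r"
    proof (cases "r \<in> {0<..<1}")
      case True
      then show ?thesis
        using mean_weight_eq_circle_integral[OF hol p \<alpha>, of r] by (simp add: h_def norm_mult)
    qed simp
  qed
  have JF: "(\<integral>\<^sup>+r\<in>{0<..<1}. ennreal (integral_mean_pow p r F * radial_weight \<alpha> r) \<partial>lborel) =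
      (\<integral>\<^sup>+r\<in>{0<..<1}. (\<integral>\<^sup>+t\<in>{0<..<2*pi}.
        ennreal (h (\<Phi> (of_real r * cis t)) * (norm (deriv \<Phi> (of_real r * cis t)))\<^sup>2 * r) \<partial>lborel) \<partial>lborel)"
  proof (rule nn_integral_cong)
    fix r :: real
    show "ennreal (integral_mean_pow p r F * radial_weight \<alpha> r) * indicator {0<..<1} r =
        (\<integral>\<^sup>+t\<in>{0<..<2*pi}. ennreal (h (\<Phi> (of_real r * cis t)) * (norm (deriv \<Phi> (of_real r * cis t)))\<^sup>2 * r) \<partial>lborel)
          * indicator {0<..<1} r"
    proof (cases "r \<in> {0<..<1}")
      case True
      then show ?thesis
        using mean_weight_eq_circle_integral[OF holF p \<alpha>, of r] by (simp add: pull norm_mult)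
    qed simp
  qed
  have "b \<in> ball 0 1 \<Longrightarrow> f b \<noteq> 0 \<Longrightarrow> (\<integral>\<^sup>+r\<in>{0<..<1}. ennreal (integral_mean_pow p r f * radial_weight \<alpha> r) \<partial>lborel) \<le> wnorm_pow \<alpha> p f" for b
    by (rule wnorm_pow_ge_weighted_mean[OF \<alpha> p hol])
  then have le: "(\<integral>\<^sup>+r\<in>{0<..<1}. ennreal (integral_mean_pow p r f * radial_weight \<alpha> r) \<partial>lborel) \<le> wnorm_pow \<alpha> p f"
    using w by auto
  show ?thesis
  proof (cases "(\<integral>\<^sup>+r\<in>{0<..<1}. ennreal (integral_mean_pow p r f * radial_weight \<alpha> r) \<partial>lborel) < \<infinity>")
    case False
    then have "\<infinity> \<le> wnorm_pow \<alpha> p f" using le unfolding not_less by (rule order_trans)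
    then have "wnorm_pow \<alpha> p f = \<infinity>" by (simp add: top_unique)
    then show ?thesis by simp
  next
    case True
    have "ennreal (norm (f w) powr p * (1 - (norm w)\<^sup>2) powr \<alpha>) = ennreal (norm (F 0) powr p)"
      by (simp add: F0 x_def)
    also have "\<dots> < (\<integral>\<^sup>+r\<in>{0<..<1}. ennreal (integral_mean_pow p r F * radial_weight \<alpha> r) \<partial>lborel)"
      by (rule weighted_mean_gt_center[OF \<alpha> p holF \<open>F 0 \<noteq> 0\<close> a'(1) \<open>F a' = 0\<close>])
    also have "\<dots> = (\<integral>\<^sup>+r\<in>{0<..<1}. ennreal (integral_mean_pow p r f * radial_weight \<alpha> r) \<partial>lborel)"
      unfolding J JF
      by (rule polar_integral_invariant[OF hol\<Phi> inj im cont_h h0]) (use True J in simp)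
    also have "\<dots> \<le> wnorm_pow \<alpha> p f" by (rule le)
    finally show ?thesis .
  qed
qed

section \<open>The pointwise estimate and its extremal functions\<close>

theorem corollary1p2:
  fixes \<alpha> p :: real
  assumes "0 < \<alpha>" and "0 < p"
  shows "(\<forall>f \<in> A_space \<alpha> p. \<forall>w \<in> ball (0::complex) 1.
            ennreal (norm (f w) powr p * (1 - (norm w)\<^sup>2) powr \<alpha>) \<le> wnorm_pow \<alpha> p f) \<and>
         (\<forall>f \<in> A_space \<alpha> p. \<forall>w \<in> ball (0::complex) 1.
            ennreal (norm (f w) powr p * (1 - (norm w)\<^sup>2) powr \<alpha>) = wnorm_pow \<alpha> p f \<longleftrightarrow>
            (\<exists>C::complex. \<forall>z \<in> ball 0 1.
               f z = C * (1 - cnj w * z) powr (of_real (- 2 * \<alpha> / p))))"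
proof -
  have strict: "ennreal (norm (f w) powr p * (1 - (norm w)\<^sup>2) powr \<alpha>) < wnorm_pow \<alpha> p f"
    if "f holomorphic_on ball 0 1" "norm w < 1" "f w \<noteq> 0" "norm a < 1" "f a = 0" for f and w a :: complex
    using wnorm_pow_strict_of_zero_le_1[OF assms(1) _ assms(2) that]
      wnorm_pow_strict_of_zero_gt_1[OF _ assms(2) that] by (cases "\<alpha> \<le> 1") auto
  have ineq: "ennreal (norm (f w) powr p * (1 - (norm w)\<^sup>2) powr \<alpha>) \<le> wnorm_pow \<alpha> p f"
    if f: "f \<in> A_space \<alpha> p" and w: "w \<in> ball 0 1" for f and w :: complex
  proof (cases "\<exists>a \<in> ball 0 1. f a = 0")
    case True
    then obtain a where "norm a < 1" "f a = 0" by auto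
    then show ?thesis
      using strict[of f w a] f w assms by (cases "f w = 0") (auto simp: A_space_def intro: less_imp_le)
  next
    case False
    then show ?thesis
      using f w assms by (intro wnorm_pow_zero_free_ge) (auto simp: A_space_def)
  qed
  have "\<exists>C. \<forall>z \<in> ball 0 1. f z = C * (1 - cnj w * z) powr (of_real (- 2 * \<alpha> / p))"
    if f: "f \<in> A_space \<alpha> p" and w: "w \<in> ball 0 1"
      and eq: "ennreal (norm (f w) powr p * (1 - (norm w)\<^sup>2) powr \<alpha>) = wnorm_pow \<alpha> p f" for f and w :: complex
  proof -
    have hol: "f holomorphic_on ball 0 1" using f by (simp add: A_space_def)
    consider "\<forall>z \<in> ball 0 1. f z = 0" | "\<forall>z \<in> ball 0 1. f z \<noteq> 0"
      | a b where "a \<in> ball 0 1" "f a = 0" "b \<in> ball 0 1" "f b \<noteq> 0" by blast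
    then show ?thesis
    proof cases
      case 1
      then show ?thesis by (intro exI[of _ 0]) auto
    next
      case 2
      then obtain C where "\<And>z. z \<in> ball 0 1 \<Longrightarrow> f z = C * (1 - cnj w * z) powr (of_real (- 2 * \<alpha> / p))"
        using wnorm_pow_zero_free_equality[OF hol _ assms _ eq] w by auto
      then show ?thesis by blast
    next
      case 3
      \<comment> \<open>otherwise the strict inequality would hold at \<open>w\<close>\<close>
      have "f w = 0"
        using strict[OF hol, of w a] 3 w eq by auto
      then have "wnorm_pow \<alpha> p f = 0" using eq assms by simp
      then show ?thesis using strict[OF hol, of b a] 3 by simp
    qed
  qed
  moreover have "ennreal (norm (f w) powr p * (1 - (norm w)\<^sup>2) powr \<alpha>) = wnorm_pow \<alpha> p f"
    if "w \<in> ball 0 1" "\<exists>C. \<forall>z \<in> ball 0 1. f z = C * (1 - cnj w * z) powr (of_real (- 2 * \<alpha> / p))" for f and w :: complex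
    using that wnorm_pow_kernel[OF assms, of w f] by auto
  ultimately show ?thesis using ineq by blast
qed

end
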